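(* The property that an umbilical lightlike normal vector field on a codimension-two spacelike submanifold in a spacetime can be rescaled to be parallel is invariant under conformal transformations of the ambient spacetime. That is: let $(M,g)$ be a spacetime of dimension $n+2\ge4$, let $u\in C^\infty(M)$ and $g^*=e^{2u}g$, let $S$ be a codimension-two spacelike submanifold of $M$, and let $\xi$ be an umbilical lightlike normal vector field on $S$. Then $\xi$ can be rescaled to be parallel with respect to the normal connection of $S$ in $(M,g)$ if and only if $\xi$ can be rescaled to be parallel with respect to the normal connection of $S$ in $(M,g^* )$.
   Context: A spacetime $(M,g)$ is a connected time-oriented Lorentzian manifold of signature $(-,+,\dots,+)$. A vector $v$ is lightlike if $g(v,v)=0$ and $v\ne0$. A codimension-two spacelike submanifold is an immersion $\psi\colon S\to M$ of a connected $n$-manifold whose induced metric is Riemannian (the spacelike, lightlike and normality conditions are the same for $g$ and $g^*$). For a normal field $\zeta$, the Weingarten formula $\widetilde\nabla_X\zeta=-A_\zeta X+\nabla^\perp_X\zeta$ (with $\widetilde\nabla$ the Levi-Civita connection of the ambient metric considered) defines the shape operator $A_\zeta$ and the normal connection $\nabla^\perp$. $\zeta$ is umbilical if $A_\zeta=\rho I$ for some function $\rho$; this notion is the same for $g$ and $g^*$. "$\xi$ can be rescaled to be parallel" means that there is a nowhere vanishing smooth function $h$ on $S$ with $\nabla^\perp(h\xi)=0$. *)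

theory Defs
  imports "HOL-Analysis.Analysis"
begin

text \<open>
  Smooth (pseudo-Riemannian) manifolds are developed here directly from charts. A manifold is
  an abstract topology on a carrier of type \<open>'a\<close> with a smooth atlas modelled on a Euclidean
  space \<open>'e\<close>, so that its dimension is \<open>DIM('e)\<close>. The atlas need not be maximal: every notion
  below that quantifies over charts gives the same result for all compatible atlases.
\<close>


section \<open>Smooth maps between open subsets of Euclidean spaces\<close>

text \<open>Meaningful for open \<open>U\<close>: continuity of all iterated directional derivatives up to
  order \<open>k\<close>.\<close>

primrec Ck_on :: "nat \<Rightarrow> 'e::euclidean_space set \<Rightarrow> ('e \<Rightarrow> 'f::real_normed_vector) \<Rightarrow> bool" where
  "Ck_on 0 U = (\<lambda>f. continuous_on U f)"
| "Ck_on (Suc k) U = (\<lambda>f. (\<forall>x\<in>U. f differentiable (at x)) \<and>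
      (\<forall>v. Ck_on k U (\<lambda>x. frechet_derivative f (at x) v)))"

definition smooth_on :: "'e::euclidean_space set \<Rightarrow> ('e \<Rightarrow> 'f::real_normed_vector) \<Rightarrow> bool" where
  "smooth_on U f \<longleftrightarrow> (\<forall>k. Ck_on k U f)"


section \<open>Manifolds and smooth maps\<close>

type_synonym ('a, 'e) chart = "'a set \<times> ('a \<Rightarrow> 'e)"

abbreviation cdom :: "('a, 'e) chart \<Rightarrow> 'a set" where "cdom c \<equiv> fst c"
abbreviation cmap :: "('a, 'e) chart \<Rightarrow> 'a \<Rightarrow> 'e" where "cmap c \<equiv> snd c"
abbreviation cimage :: "('a, 'e) chart \<Rightarrow> 'e set" where "cimage c \<equiv> cmap c ` cdom c"

definition cinv :: "('a, 'e) chart \<Rightarrow> 'e \<Rightarrow> 'a" where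
  "cinv c = inv_into (cdom c) (cmap c)"

record ('a, 'e) manifold =
  mtop :: "'a topology"
  charts :: "('a, 'e) chart set"

abbreviation points :: "('a, 'e) manifold \<Rightarrow> 'a set" where
  "points M \<equiv> topspace (mtop M)"

definition smooth_manifold :: "('a, 'e::euclidean_space) manifold \<Rightarrow> bool" where
  "smooth_manifold M \<longleftrightarrow>
     Hausdorff_space (mtop M) \<and> second_countable (mtop M) \<and>
     \<Union> (cdom ` charts M) = points M \<and>
     (\<forall>c\<in>charts M. openin (mtop M) (cdom c) \<and> open (cimage c) \<and>
        homeomorphic_map (subtopology (mtop M) (cdom c)) (top_of_set (cimage c)) (cmap c)) \<and>
     (\<forall>c\<in>charts M. \<forall>c'\<in>charts M.
        smooth_on (cmap c ` (cdom c \<inter> cdom c')) (cmap c' \<circ> cinv c))"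

definition smooth_fun :: "('a, 'e::euclidean_space) manifold \<Rightarrow> ('a \<Rightarrow> real) \<Rightarrow> bool" where
  "smooth_fun M f \<longleftrightarrow> (\<forall>c\<in>charts M. smooth_on (cimage c) (f \<circ> cinv c))"

definition smooth_map ::
  "('s, 'f::euclidean_space) manifold \<Rightarrow> ('a, 'e::euclidean_space) manifold \<Rightarrow> ('s \<Rightarrow> 'a) \<Rightarrow> bool" where
  "smooth_map S M \<psi> \<longleftrightarrow> continuous_map (mtop S) (mtop M) \<psi> \<and>
     (\<forall>d\<in>charts S. \<forall>c\<in>charts M.
        smooth_on (cmap d ` (cdom d \<inter> \<psi> -` cdom c)) (cmap c \<circ> \<psi> \<circ> cinv d))"


section \<open>Tangent vectors\<close>

text \<open>
  A tangent vector at \<open>p\<close> is the family of its components in all charts around \<open>p\<close>, related by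
  the derivatives of the coordinate changes. The components in the other charts are set
  to \<open>0\<close>, so that \<open>\<lambda>_. 0\<close> is the zero vector and the vector space operations are the pointwise
  ones.
\<close>

type_synonym ('a, 'e) tvec = "('a, 'e) chart \<Rightarrow> 'e"

definition charts_at :: "('a, 'e) manifold \<Rightarrow> 'a \<Rightarrow> ('a, 'e) chart set" where
  "charts_at M p = {c \<in> charts M. p \<in> cdom c}"

definition chart_at :: "('a, 'e) manifold \<Rightarrow> 'a \<Rightarrow> ('a, 'e) chart" where
  "chart_at M p = (SOME c. c \<in> charts_at M p)"

definition tangent_space :: "('a, 'e::euclidean_space) manifold \<Rightarrow> 'a \<Rightarrow> ('a, 'e) tvec set" where
  "tangent_space M p = {v.
     (\<forall>c\<in>charts_at M p. \<forall>c'\<in>charts_at M p.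
        v c' = frechet_derivative (cmap c' \<circ> cinv c) (at (cmap c p)) (v c)) \<and>
     (\<forall>c. c \<notin> charts_at M p \<longrightarrow> v c = 0)}"

text \<open>The tangent vector at \<open>p\<close> whose component in the chart \<open>c\<close> is \<open>a\<close>, i.e. the value at \<open>p\<close> of
  the constant-coefficient coordinate field given by \<open>a\<close>.\<close>

definition coord_vec ::
  "('a, 'e::euclidean_space) manifold \<Rightarrow> ('a, 'e) chart \<Rightarrow> 'a \<Rightarrow> 'e \<Rightarrow> ('a, 'e) tvec" where
  "coord_vec M c p a = (\<lambda>c'. if c' \<in> charts_at M p
     then frechet_derivative (cmap c' \<circ> cinv c) (at (cmap c p)) a else 0)"

definition smooth_vector_field_on ::
  "('a, 'e::euclidean_space) manifold \<Rightarrow> 'a set \<Rightarrow> ('a \<Rightarrow> ('a, 'e) tvec) \<Rightarrow> bool" where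
  "smooth_vector_field_on M U V \<longleftrightarrow>
     (\<forall>p\<in>U. V p \<in> tangent_space M p) \<and>
     (\<forall>c\<in>charts M. smooth_on (cmap c ` (cdom c \<inter> U)) (\<lambda>x. V (cinv c x) c))"

text \<open>The differential. By the chain rule its value does not depend on the chart of \<open>S\<close> used.\<close>

definition differential ::
  "('s, 'f::euclidean_space) manifold \<Rightarrow> ('a, 'e::euclidean_space) manifold \<Rightarrow> ('s \<Rightarrow> 'a) \<Rightarrow> 's
    \<Rightarrow> ('s, 'f) tvec \<Rightarrow> ('a, 'e) tvec" where
  "differential S M \<psi> s v = (\<lambda>c. if c \<in> charts_at M (\<psi> s)
     then let d = chart_at S s in
       frechet_derivative (cmap c \<circ> \<psi> \<circ> cinv d) (at (cmap d s)) (v d)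
     else 0)"

definition immersion ::
  "('s, 'f::euclidean_space) manifold \<Rightarrow> ('a, 'e::euclidean_space) manifold \<Rightarrow> ('s \<Rightarrow> 'a) \<Rightarrow> bool" where
  "immersion S M \<psi> \<longleftrightarrow> smooth_map S M \<psi> \<and>
     (\<forall>s\<in>points S. inj_on (differential S M \<psi> s) (tangent_space S s))"


section \<open>Metrics and spacetimes\<close>

type_synonym ('a, 'e) metric = "'a \<Rightarrow> ('a, 'e) tvec \<Rightarrow> ('a, 'e) tvec \<Rightarrow> real"

definition metric_comp ::
  "('a, 'e::euclidean_space) manifold \<Rightarrow> ('a, 'e) metric \<Rightarrow> ('a, 'e) chart \<Rightarrow> 'e \<Rightarrow> 'e \<Rightarrow> 'e \<Rightarrow> real" where
  "metric_comp M g c x a b =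
     (let p = cinv c x in g p (coord_vec M c p a) (coord_vec M c p b))"

definition smooth_symmetric_form ::
  "('a, 'e::euclidean_space) manifold \<Rightarrow> ('a, 'e) metric \<Rightarrow> bool" where
  "smooth_symmetric_form M g \<longleftrightarrow>
     (\<forall>p\<in>points M. \<forall>v\<in>tangent_space M p. \<forall>w\<in>tangent_space M p.
        g p v w = g p w v \<and>
        (\<forall>z\<in>tangent_space M p. \<forall>r.
           g p (\<lambda>c. r *\<^sub>R v c + w c) z = r * g p v z + g p w z)) \<and>
     (\<forall>c\<in>charts M. \<forall>a b. smooth_on (cimage c) (\<lambda>x. metric_comp M g c x a b))"

definition riemannian_metric ::
  "('a, 'e::euclidean_space) manifold \<Rightarrow> ('a, 'e) metric \<Rightarrow> bool" where
  "riemannian_metric M g \<longleftrightarrow> smooth_symmetric_form M g \<and>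
     (\<forall>p\<in>points M. \<forall>v\<in>tangent_space M p. v \<noteq> (\<lambda>_. 0) \<longrightarrow> g p v v > 0)"

text \<open>Signature \<open>(-,+,\<dots>,+)\<close>: every tangent space has an orthonormal basis with exactly one
  (the zeroth) vector of negative square. The \<open>DIM('e)\<close> orthonormal vectors are automatically
  a basis.\<close>

definition lorentzian_metric ::
  "('a, 'e::euclidean_space) manifold \<Rightarrow> ('a, 'e) metric \<Rightarrow> bool" where
  "lorentzian_metric M g \<longleftrightarrow> smooth_symmetric_form M g \<and>
     (\<forall>p\<in>points M. \<exists>E :: nat \<Rightarrow> ('a, 'e) tvec.
        (\<forall>i<DIM('e). E i \<in> tangent_space M p) \<and>
        (\<forall>i<DIM('e). \<forall>j<DIM('e).
           g p (E i) (E j) = (if i \<noteq> j then 0 else if i = 0 then - 1 else 1)))"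

definition timelike :: "('a, 'e) metric \<Rightarrow> 'a \<Rightarrow> ('a, 'e::euclidean_space) tvec \<Rightarrow> bool" where
  "timelike g p v \<longleftrightarrow> g p v v < 0"

definition lightlike :: "('a, 'e) metric \<Rightarrow> 'a \<Rightarrow> ('a, 'e::euclidean_space) tvec \<Rightarrow> bool" where
  "lightlike g p v \<longleftrightarrow> g p v v = 0 \<and> v \<noteq> (\<lambda>_. 0)"

text \<open>A time orientation is a smooth choice \<open>\<tau>\<close> of one of the two time cones in each tangent
  space.\<close>

definition time_orientation ::
  "('a, 'e::euclidean_space) manifold \<Rightarrow> ('a, 'e) metric \<Rightarrow> ('a \<Rightarrow> ('a, 'e) tvec set) \<Rightarrow> bool" where
  "time_orientation M g \<tau> \<longleftrightarrow>
     (\<forall>p\<in>points M. \<exists>U V. openin (mtop M) U \<and> p \<in> U \<and> smooth_vector_field_on M U V \<and>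
        (\<forall>q\<in>U. timelike g q (V q) \<and>
           \<tau> q = {v \<in> tangent_space M q. timelike g q v \<and> g q (V q) v < 0}))"

definition spacetime ::
  "('a, 'e::euclidean_space) manifold \<Rightarrow> ('a, 'e) metric \<Rightarrow> ('a \<Rightarrow> ('a, 'e) tvec set) \<Rightarrow> bool" where
  "spacetime M g \<tau> \<longleftrightarrow> smooth_manifold M \<and> connected_space (mtop M) \<and>
     lorentzian_metric M g \<and> time_orientation M g \<tau>"

definition conformal_metric :: "('a \<Rightarrow> real) \<Rightarrow> ('a, 'e) metric \<Rightarrow> ('a, 'e) metric" where
  "conformal_metric u g = (\<lambda>p v w. exp (2 * u p) * g p v w)"


section \<open>The Levi-Civita connection\<close>

text \<open>
  The Levi-Civita connection is expressed in a chart \<open>c\<close> by its connection coefficients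
  \<open>\<Gamma> a b = \<nabla>\<^sub>a \<partial>\<^sub>b\<close> for the coordinate fields with constant components \<open>a\<close> and \<open>b\<close>. Since
  coordinate fields commute, vanishing torsion is symmetry of \<open>\<Gamma>\<close>. The last condition is
  compatibility with the metric.
\<close>

definition levi_civita ::
  "('a, 'e::euclidean_space) manifold \<Rightarrow> ('a, 'e) metric \<Rightarrow> ('a, 'e) chart \<Rightarrow> 'e \<Rightarrow> 'e \<Rightarrow> 'e \<Rightarrow> 'e" where
  "levi_civita M g c x = (THE \<Gamma>. bilinear \<Gamma> \<and>
     (\<forall>a b. \<Gamma> a b = \<Gamma> b a) \<and>
     (\<forall>a b b'. frechet_derivative (\<lambda>y. metric_comp M g c y b b') (at x) a =
        metric_comp M g c x (\<Gamma> a b) b' + metric_comp M g c x b (\<Gamma> a b')))"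


section \<open>Spacelike submanifolds and fields along them\<close>

definition induced_metric ::
  "('s, 'f::euclidean_space) manifold \<Rightarrow> ('a, 'e::euclidean_space) manifold \<Rightarrow> ('a, 'e) metric
    \<Rightarrow> ('s \<Rightarrow> 'a) \<Rightarrow> ('s, 'f) metric" where
  "induced_metric S M g \<psi> =
     (\<lambda>s v w. g (\<psi> s) (differential S M \<psi> s v) (differential S M \<psi> s w))"

definition spacelike_submanifold ::
  "('s, 'f::euclidean_space) manifold \<Rightarrow> ('a, 'e::euclidean_space) manifold \<Rightarrow> ('a, 'e) metric
    \<Rightarrow> ('s \<Rightarrow> 'a) \<Rightarrow> bool" where
  "spacelike_submanifold S M g \<psi> \<longleftrightarrow> smooth_manifold S \<and> connected_space (mtop S) \<and>
     immersion S M \<psi> \<and> riemannian_metric S (induced_metric S M g \<psi>)"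

definition smooth_field_along ::
  "('s, 'f::euclidean_space) manifold \<Rightarrow> ('a, 'e::euclidean_space) manifold \<Rightarrow> ('s \<Rightarrow> 'a)
    \<Rightarrow> ('s \<Rightarrow> ('a, 'e) tvec) \<Rightarrow> bool" where
  "smooth_field_along S M \<psi> \<zeta> \<longleftrightarrow>
     (\<forall>s\<in>points S. \<zeta> s \<in> tangent_space M (\<psi> s)) \<and>
     (\<forall>d\<in>charts S. \<forall>c\<in>charts M.
        smooth_on (cmap d ` (cdom d \<inter> \<psi> -` cdom c)) (\<lambda>y. \<zeta> (cinv d y) c))"

definition normal_space ::
  "('s, 'f::euclidean_space) manifold \<Rightarrow> ('a, 'e::euclidean_space) manifold \<Rightarrow> ('a, 'e) metric
    \<Rightarrow> ('s \<Rightarrow> 'a) \<Rightarrow> 's \<Rightarrow> ('a, 'e) tvec set" where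
  "normal_space S M g \<psi> s = {w \<in> tangent_space M (\<psi> s).
     \<forall>v\<in>tangent_space S s. g (\<psi> s) w (differential S M \<psi> s v) = 0}"

definition normal_field ::
  "('s, 'f::euclidean_space) manifold \<Rightarrow> ('a, 'e::euclidean_space) manifold \<Rightarrow> ('a, 'e) metric
    \<Rightarrow> ('s \<Rightarrow> 'a) \<Rightarrow> ('s \<Rightarrow> ('a, 'e) tvec) \<Rightarrow> bool" where
  "normal_field S M g \<psi> \<zeta> \<longleftrightarrow> smooth_field_along S M \<psi> \<zeta> \<and>
     (\<forall>s\<in>points S. \<zeta> s \<in> normal_space S M g \<psi> s)"

text \<open>
  The ambient covariant derivative at \<open>s\<close>, in the direction \<open>v\<close> tangent to \<open>S\<close>, of a field
  \<open>\<zeta>\<close> along \<open>\<psi>\<close>: with \<open>\<zeta> = \<Sum>\<^sub>j \<zeta>\<^sup>j \<partial>\<^sub>j\<close> in a chart of \<open>M\<close> it is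
  \<open>\<Sum>\<^sub>j (v(\<zeta>\<^sup>j) \<partial>\<^sub>j + \<zeta>\<^sup>j \<nabla>\<^bsub>d\<psi>(v)\<^esub> \<partial>\<^sub>j)\<close>. By the transformation laws of
  tangent vectors and connection coefficients this tangent vector does not depend on the charts.
\<close>

definition covariant_derivative ::
  "('s, 'f::euclidean_space) manifold \<Rightarrow> ('a, 'e::euclidean_space) manifold \<Rightarrow> ('a, 'e) metric
    \<Rightarrow> ('s \<Rightarrow> 'a) \<Rightarrow> ('s \<Rightarrow> ('a, 'e) tvec) \<Rightarrow> 's \<Rightarrow> ('s, 'f) tvec \<Rightarrow> ('a, 'e) tvec" where
  "covariant_derivative S M g \<psi> \<zeta> s v =
     (let d = chart_at S s; c = chart_at M (\<psi> s) in
      coord_vec M c (\<psi> s)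
        (frechet_derivative (\<lambda>y. \<zeta> (cinv d y) c) (at (cmap d s)) (v d)
         + levi_civita M g c (cmap c (\<psi> s)) (differential S M \<psi> s v c) (\<zeta> s c)))"

text \<open>The shape operator and the normal connection are the two parts of the Weingarten
  decomposition \<open>\<nabla>\<^sub>v \<zeta> = - A\<^sub>\<zeta> v + \<nabla>\<^sup>\<bottom>\<^sub>v \<zeta>\<close> of the ambient covariant derivative into a
  tangential and a normal component.\<close>

definition shape_operator ::
  "('s, 'f::euclidean_space) manifold \<Rightarrow> ('a, 'e::euclidean_space) manifold \<Rightarrow> ('a, 'e) metric
    \<Rightarrow> ('s \<Rightarrow> 'a) \<Rightarrow> ('s \<Rightarrow> ('a, 'e) tvec) \<Rightarrow> 's \<Rightarrow> ('s, 'f) tvec \<Rightarrow> ('s, 'f) tvec" where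
  "shape_operator S M g \<psi> \<zeta> s v = (THE a. a \<in> tangent_space S s \<and>
     (\<lambda>c. covariant_derivative S M g \<psi> \<zeta> s v c + differential S M \<psi> s a c)
       \<in> normal_space S M g \<psi> s)"

definition normal_connection ::
  "('s, 'f::euclidean_space) manifold \<Rightarrow> ('a, 'e::euclidean_space) manifold \<Rightarrow> ('a, 'e) metric
    \<Rightarrow> ('s \<Rightarrow> 'a) \<Rightarrow> ('s \<Rightarrow> ('a, 'e) tvec) \<Rightarrow> 's \<Rightarrow> ('s, 'f) tvec \<Rightarrow> ('a, 'e) tvec" where
  "normal_connection S M g \<psi> \<zeta> s v = (\<lambda>c. covariant_derivative S M g \<psi> \<zeta> s v c
     + differential S M \<psi> s (shape_operator S M g \<psi> \<zeta> s v) c)"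

definition umbilical ::
  "('s, 'f::euclidean_space) manifold \<Rightarrow> ('a, 'e::euclidean_space) manifold \<Rightarrow> ('a, 'e) metric
    \<Rightarrow> ('s \<Rightarrow> 'a) \<Rightarrow> ('s \<Rightarrow> ('a, 'e) tvec) \<Rightarrow> bool" where
  "umbilical S M g \<psi> \<zeta> \<longleftrightarrow> (\<exists>\<rho> :: 's \<Rightarrow> real. \<forall>s\<in>points S. \<forall>v\<in>tangent_space S s.
     shape_operator S M g \<psi> \<zeta> s v = (\<lambda>d. \<rho> s *\<^sub>R v d))"

definition parallel_normal ::
  "('s, 'f::euclidean_space) manifold \<Rightarrow> ('a, 'e::euclidean_space) manifold \<Rightarrow> ('a, 'e) metric
    \<Rightarrow> ('s \<Rightarrow> 'a) \<Rightarrow> ('s \<Rightarrow> ('a, 'e) tvec) \<Rightarrow> bool" where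
  "parallel_normal S M g \<psi> \<zeta> \<longleftrightarrow> (\<forall>s\<in>points S. \<forall>v\<in>tangent_space S s.
     normal_connection S M g \<psi> \<zeta> s v = (\<lambda>_. 0))"

definition rescalable_to_parallel ::
  "('s, 'f::euclidean_space) manifold \<Rightarrow> ('a, 'e::euclidean_space) manifold \<Rightarrow> ('a, 'e) metric
    \<Rightarrow> ('s \<Rightarrow> 'a) \<Rightarrow> ('s \<Rightarrow> ('a, 'e) tvec) \<Rightarrow> bool" where
  "rescalable_to_parallel S M g \<psi> \<xi> \<longleftrightarrow> (\<exists>h. smooth_fun S h \<and>
     (\<forall>s\<in>points S. h s \<noteq> 0) \<and> parallel_normal S M g \<psi> (\<lambda>s c. h s *\<^sub>R \<xi> s c))"

end

theory Submission
  imports Defs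
begin

text \<open>
  By the Koszul formula the Levi-Civita connection of \<open>g\<^sup>* = e\<^sup>2\<^sup>u g\<close> is
  \<open>\<nabla>\<^sup>*\<^sub>a b = \<nabla>\<^sub>a b + du(a) b + du(b) a - g(a, b) grad u\<close>. For \<open>v\<close> tangent
  to \<open>S\<close> and \<open>\<zeta>\<close> normal the last term vanishes and \<open>du(\<zeta>) v\<close> is tangential, so that the normal
  connections differ by \<open>du(v) \<zeta>\<close> only. This is cancelled by rescaling: the normal derivative of
  \<open>exp(-u) \<zeta>\<close> with respect to \<open>g\<^sup>*\<close> is \<open>exp(-u)\<close> times that of \<open>\<zeta>\<close> with respect to \<open>g\<close>. Hence
  \<open>h \<xi>\<close> is parallel for \<open>g\<close> iff \<open>exp(-u) h \<xi>\<close> is parallel for \<open>g\<^sup>*\<close>.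
\<close>

section \<open>Calculus of smooth maps\<close>

text \<open>The weight \<open>exp(-u)\<close> is forced: the normal derivative of \<open>f\<close>
  times \<zeta> picks up the correction \<open>df(v) + f du(v)\<close> in front of \<zeta>, and this
  vanishes exactly for \<open>df = - f du\<close>. The obstacle is that \<open>levi_civita\<close>
  and \<open>shape_operator\<close> are definite descriptions, which yield information only after
  unique existence has been shown. For the connection this becomes linear algebra at a single point:
  the metric and its first derivatives there are treated as abstract data, and the Koszul expression
  is represented through a nondegenerate form. For the shape operator the decomposition into
  tangential and normal part is established for \<open>g\<close> alone; it serves
  \<open>conformal_metric u g\<close> too, since both metrics have the same normal spaces. The
  gradient of \<open>u\<close> stays an unspecified vector \<open>G\<close>, because its coefficient
  vanishes on a tangential and a normal argument.

  The block above contains a typing error and is void. The complete reply follows.\<close>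

text \<open>Chain rule in the form that charts require: a coordinate expression factors through
  another chart only near the point, where the chart domains overlap.\<close>

lemma has_derivative_compose_eventually:
  assumes "g differentiable at x" and "f differentiable at (g x)"
    and "\<forall>\<^sub>F y in nhds x. h y = f (g y)"
  shows "(h has_derivative (\<lambda>v. frechet_derivative f (at (g x)) (frechet_derivative g (at x) v))) (at x)"
proof -
  have "(g has_derivative frechet_derivative g (at x)) (at x)"
    and "(f has_derivative frechet_derivative f (at (g x))) (at (g x))"
    using assms(1,2) by (simp_all add: frechet_derivative_works)
  then have "((\<lambda>y. f (g y)) has_derivative
      (\<lambda>v. frechet_derivative f (at (g x)) (frechet_derivative g (at x) v))) (at x)"
    by (rule has_derivative_compose)
  moreover have "\<forall>\<^sub>F y in at x. f (g y) = h y"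
    using assms(3) by (auto simp: eventually_nhds_conv_at elim: eventually_mono)
  moreover have "f (g x) = h x"
    using eventually_nhds_x_imp_x[OF assms(3)] by simp
  ultimately show ?thesis
    by (rule has_derivative_transform_eventually) simp
qed

lemma frechet_derivative_eqI:
  "(f has_derivative f') (at x) \<Longrightarrow> frechet_derivative f (at x) v = f' v"
  by (rule fun_cong[OF frechet_derivative_at[symmetric]])

lemma frechet_derivative_cong_open:
  assumes "open U" and "x \<in> U" and "\<And>y. y \<in> U \<Longrightarrow> f y = g y"
  shows "frechet_derivative f (at x) = frechet_derivative g (at x)"
    and "f differentiable at x \<longleftrightarrow> g differentiable at x"
proof -
  have "(f has_derivative D) (at x) \<longleftrightarrow> (g has_derivative D) (at x)" for D
    using has_derivative_transform_within_open[OF _ assms(1,2)] assms(3) by metis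
  then show "frechet_derivative f (at x) = frechet_derivative g (at x)"
    and "f differentiable at x \<longleftrightarrow> g differentiable at x"
    by (simp_all add: frechet_derivative_def differentiable_def)
qed

section \<open>Locality and closure properties of the classes \<open>Ck_on\<close>\<close>

text \<open>In the inductions below the derivative has a closed formula only at points of
  \<open>U\<close>; openness of \<open>U\<close> lets that formula replace
  \<open>frechet_derivative\<close> inside \<open>Ck_on\<close>.\<close>

lemma Ck_on_cong:
  assumes "open U" and "\<And>x. x \<in> U \<Longrightarrow> f x = g x" and "Ck_on k U f"
  shows "Ck_on k U g"
  using assms(2,3)
proof (induction k arbitrary: f g)
  case 0
  then show ?case by (auto cong: continuous_on_cong)
next
  case (Suc k)
  have "frechet_derivative f (at x) v = frechet_derivative g (at x) v" if "x \<in> U" for x v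
    using frechet_derivative_cong_open(1)[OF assms(1) that Suc.prems(1)] by simp
  then show ?case
    using Suc.prems(2) Suc.IH[of "\<lambda>x. frechet_derivative f (at x) v" "\<lambda>x. frechet_derivative g (at x) v" for v]
      frechet_derivative_cong_open(2)[OF assms(1) _ Suc.prems(1)]
    by simp
qed

lemma Ck_on_subset: "Ck_on k U f \<Longrightarrow> V \<subseteq> U \<Longrightarrow> Ck_on k V f"
  by (induction k arbitrary: f) (auto intro: continuous_on_subset)

lemma Ck_on_local:
  assumes "\<And>x. x \<in> U \<Longrightarrow> \<exists>V. open V \<and> x \<in> V \<and> Ck_on k V f"
  shows "Ck_on k U f"
  using assms
proof (induction k arbitrary: f)
  case 0
  have "isCont f x" if "x \<in> U" for x
    using 0[OF that] by (auto simp: continuous_on_eq_continuous_at)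
  then show ?case
    by (simp add: continuous_at_imp_continuous_on)
next
  case (Suc k)
  have "Ck_on k U (\<lambda>x. frechet_derivative f (at x) v)" for v
    by (rule Suc.IH) (use Suc.prems in fastforce)
  moreover have "\<forall>x\<in>U. f differentiable at x"
    using Suc.prems by fastforce
  ultimately show ?case
    by simp
qed

text \<open>Product and chain rule leave undifferentiated factors behind, which are known at order
  \<open>Suc k\<close> but enter the induction hypothesis at order \<open>k\<close>.\<close>

lemma Ck_on_SucD: "Ck_on (Suc k) U f \<Longrightarrow> Ck_on k U f"
proof (induction k arbitrary: f)
  case 0
  then show ?case
    by (auto intro!: continuous_at_imp_continuous_on differentiable_imp_continuous_within)
next
  case (Suc k)
  have "Ck_on k U (\<lambda>x. frechet_derivative f (at x) v)" for v
    by (rule Suc.IH) (use Suc.prems in simp)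
  moreover have "\<forall>x\<in>U. f differentiable at x"
    using Suc.prems by simp
  ultimately show ?case
    by simp
qed

lemma frechet_derivative_add_at:
  assumes "f differentiable at x" and "g differentiable at x"
  shows "frechet_derivative (\<lambda>x. f x + g x) (at x) v = frechet_derivative f (at x) v + frechet_derivative g (at x) v"
proof -
  have "((\<lambda>x. f x + g x) has_derivative
      (\<lambda>v. frechet_derivative f (at x) v + frechet_derivative g (at x) v)) (at x)"
    using assms by (intro has_derivative_add) (auto simp: frechet_derivative_works)
  then show ?thesis
    by (rule frechet_derivative_eqI)
qed

lemma Ck_on_add:
  assumes "open U" and "Ck_on k U f" and "Ck_on k U g"
  shows "Ck_on k U (\<lambda>x. f x + g x)"
  using assms(2,3)
proof (induction k arbitrary: f g)
  case 0
  then show ?case by (simp add: continuous_on_add)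
next
  case (Suc k)
  have "Ck_on k U (\<lambda>x. frechet_derivative (\<lambda>x. f x + g x) (at x) v)" for v
    by (rule Ck_on_cong[OF assms(1), where f = "\<lambda>x. frechet_derivative f (at x) v + frechet_derivative g (at x) v"])
      (use Suc.prems in \<open>auto simp: frechet_derivative_add_at intro!: Suc.IH\<close>)
  then show ?case
    using Suc.prems by (auto intro: differentiable_add)
qed

lemma Ck_on_zero: "Ck_on k U (\<lambda>x. 0)"
  by (induction k) (auto simp: frechet_derivative_const)

lemma Ck_on_sum:
  assumes "open U" and "finite I" and "\<And>i. i \<in> I \<Longrightarrow> Ck_on k U (f i)"
  shows "Ck_on k U (\<lambda>x. \<Sum>i\<in>I. f i x)"
  using assms(2,3) by (induction I) (auto intro: Ck_on_add[OF assms(1)] simp: Ck_on_zero)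

lemma Ck_on_mult:
  fixes f g :: "'e::euclidean_space \<Rightarrow> real"
  assumes "open U" and "Ck_on k U f" and "Ck_on k U g"
  shows "Ck_on k U (\<lambda>x. f x * g x)"
  using assms(2,3)
proof (induction k arbitrary: f g)
  case 0
  then show ?case by (simp add: continuous_on_mult)
next
  case (Suc k)
  have fr: "frechet_derivative (\<lambda>x. f x * g x) (at x) v
      = f x * frechet_derivative g (at x) v + frechet_derivative f (at x) v * g x" if "x \<in> U" for x v
  proof -
    have "((\<lambda>x. f x * g x) has_derivative
        (\<lambda>v. f x * frechet_derivative g (at x) v + frechet_derivative f (at x) v * g x)) (at x)"
      by (intro has_derivative_mult) (use Suc.prems that in \<open>auto simp: frechet_derivative_works\<close>)
    then show ?thesis
      by (rule frechet_derivative_eqI)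
  qed
  have "Ck_on k U (\<lambda>x. frechet_derivative (\<lambda>x. f x * g x) (at x) v)" for v
    by (rule Ck_on_cong[OF assms(1), where
          f = "\<lambda>x. f x * frechet_derivative g (at x) v + frechet_derivative f (at x) v * g x"])
      (use Suc.prems Ck_on_SucD[OF Suc.prems(1)] Ck_on_SucD[OF Suc.prems(2)] in
        \<open>auto simp: fr intro!: Ck_on_add[OF assms(1)] Suc.IH\<close>)
  then show ?case
    using Suc.prems by (auto intro: differentiable_mult)
qed

lemma Ck_on_inner_right:
  assumes "open U" and "Ck_on k U f"
  shows "Ck_on k U (\<lambda>x. f x \<bullet> b)"
  using assms(2)
proof (induction k arbitrary: f)
  case 0
  then show ?case by (auto intro: continuous_intros)
next
  case (Suc k)
  have der: "((\<lambda>x. f x \<bullet> b) has_derivative (\<lambda>v. frechet_derivative f (at x) v \<bullet> b)) (at x)" if "x \<in> U" for x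
    by (intro has_derivative_inner_left) (use Suc.prems that in \<open>auto simp: frechet_derivative_works\<close>)
  have fr: "frechet_derivative (\<lambda>x. f x \<bullet> b) (at x) v = frechet_derivative f (at x) v \<bullet> b" if "x \<in> U" for x v
    by (rule frechet_derivative_eqI[OF der[OF that]])
  have "Ck_on k U (\<lambda>x. frechet_derivative (\<lambda>x. f x \<bullet> b) (at x) v)" for v
    by (rule Ck_on_cong[OF assms(1), where f = "\<lambda>x. frechet_derivative f (at x) v \<bullet> b"])
      (use Suc.prems in \<open>auto simp: fr intro!: Suc.IH\<close>)
  then show ?case
    using der by (auto simp: differentiable_def)
qed

lemma Ck_on_compose:
  fixes f :: "'e::euclidean_space \<Rightarrow> real" and g :: "'f::euclidean_space \<Rightarrow> 'e"
  assumes "open U" and "g ` U \<subseteq> V" and "Ck_on k V f" and "Ck_on k U g"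
  shows "Ck_on k U (\<lambda>x. f (g x))"
  using assms(3,4)
proof (induction k arbitrary: f)
  case 0
  then show ?case
    using assms(2) by (auto intro: continuous_on_compose2)
next
  case (Suc k)
  have df: "f differentiable at (g x)" "g differentiable at x" if "x \<in> U" for x
    using Suc.prems assms(2) that by auto
  have der: "((\<lambda>x. f (g x)) has_derivative
      (\<lambda>v. frechet_derivative f (at (g x)) (frechet_derivative g (at x) v))) (at x)" if "x \<in> U" for x
    by (rule has_derivative_compose_eventually) (use df[OF that] in auto)
  \<comment> \<open>\<open>Ck_on\<close> speaks of derivatives in fixed directions, but here the
    direction \<open>frechet_derivative g (at x) v\<close> moves with \<open>x\<close>. Expanding it
    in \<open>Basis\<close> gives a sum of products of functions that the induction hypothesis
    covers.\<close>
  have fr: "frechet_derivative (\<lambda>x. f (g x)) (at x) v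
      = (\<Sum>i\<in>Basis. (frechet_derivative g (at x) v \<bullet> i) * frechet_derivative f (at (g x)) i)" if "x \<in> U" for x v
  proof -
    have lin: "linear (frechet_derivative f (at (g x)))"
      using df[OF that] by (simp add: linear_frechet_derivative)
    have "frechet_derivative (\<lambda>x. f (g x)) (at x) v
        = frechet_derivative f (at (g x)) (frechet_derivative g (at x) v)"
      by (rule frechet_derivative_eqI[OF der[OF that]])
    also have "\<dots> = frechet_derivative f (at (g x))
        (\<Sum>i\<in>Basis. (frechet_derivative g (at x) v \<bullet> i) *\<^sub>R i)"
      by (simp add: euclidean_representation)
    also have "\<dots> = (\<Sum>i\<in>Basis. (frechet_derivative g (at x) v \<bullet> i) * frechet_derivative f (at (g x)) i)"
      by (simp add: linear_sum[OF lin] linear_scale[OF lin])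
    finally show ?thesis .
  qed
  have "Ck_on k U (\<lambda>x. frechet_derivative (\<lambda>x. f (g x)) (at x) v)" for v
    by (rule Ck_on_cong[OF assms(1), where
          f = "\<lambda>x. \<Sum>i\<in>Basis. (frechet_derivative g (at x) v \<bullet> i) * frechet_derivative f (at (g x)) i"])
      (use Suc.prems Ck_on_SucD[OF Suc.prems(2)] in
        \<open>auto simp: fr intro!: Ck_on_sum[OF assms(1)] Ck_on_mult[OF assms(1)] Ck_on_inner_right[OF assms(1)] Suc.IH\<close>)
  then show ?case
    using der by (auto simp: differentiable_def)
qed

text \<open>The derivative reproduces the exponential as a factor, so the induction hypothesis for
  the same \<open>f\<close> together with the product rule suffices.\<close>

lemma Ck_on_exp:
  fixes f :: "'e::euclidean_space \<Rightarrow> real"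
  assumes "open U" and "Ck_on k U f"
  shows "Ck_on k U (\<lambda>x. exp (r * f x))"
  using assms(2)
proof (induction k)
  case 0
  then show ?case by (auto intro!: continuous_on_exp continuous_on_mult_left)
next
  case (Suc k)
  have der: "((\<lambda>x. exp (r * f x)) has_derivative
      (\<lambda>v. exp (r * f x) * (r * frechet_derivative f (at x) v))) (at x)" if "x \<in> U" for x
  proof -
    have "((\<lambda>x. r * f x) has_derivative (\<lambda>v. r * frechet_derivative f (at x) v)) (at x)"
      by (intro has_derivative_mult_right) (use Suc.prems that in \<open>auto simp: frechet_derivative_works\<close>)
    from has_derivative_exp[OF this] show ?thesis
      by (simp add: mult_ac)
  qed
  have fr: "frechet_derivative (\<lambda>x. exp (r * f x)) (at x) v
      = exp (r * f x) * (r * frechet_derivative f (at x) v)" if "x \<in> U" for x v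
    by (rule frechet_derivative_eqI[OF der[OF that]])
  have const: "Ck_on k U (\<lambda>x. r)"
    by (cases k) (auto simp: frechet_derivative_const Ck_on_zero)
  have "Ck_on k U (\<lambda>x. frechet_derivative (\<lambda>x. exp (r * f x)) (at x) v)" for v
    by (rule Ck_on_cong[OF assms(1), where f = "\<lambda>x. exp (r * f x) * (r * frechet_derivative f (at x) v)"])
      (use Suc.prems Ck_on_SucD[OF Suc.prems] const in
        \<open>auto simp: fr intro!: Ck_on_mult[OF assms(1)] Suc.IH\<close>)
  then show ?case
    using der by (auto simp: differentiable_def)
qed

lemma smooth_on_differentiable: "smooth_on U f \<Longrightarrow> x \<in> U \<Longrightarrow> f differentiable at x"
  unfolding smooth_on_def by (metis Ck_on.simps(2))


section \<open>Linear algebra of nondegenerate forms\<close>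

definition nondegenerate :: "('e::euclidean_space \<Rightarrow> 'e \<Rightarrow> real) \<Rightarrow> bool" where
  "nondegenerate B \<longleftrightarrow> (\<forall>w. (\<forall>z. B w z = 0) \<longrightarrow> w = 0)"

lemma nondegenerate_eqI:
  assumes "bilinear B" and "nondegenerate B" and "\<And>z. B v z = B w z"
  shows "v = w"
proof -
  have "B (v - w) z = 0" for z
    using assms(1,3) by (simp add: bilinear_lsub)
  then show ?thesis
    using assms(2) unfolding nondegenerate_def by fastforce
qed

text \<open>The inner product turns \<open>B\<close> into an endomorphism \<open>A\<close>;
  nondegeneracy makes it injective, hence surjective in finite dimension. This one fact provides the
  connection from the Koszul formula, the gradient of \<open>u\<close>, and the tangential part of
  an ambient vector.\<close>

lemma nondegenerate_represents:
  assumes "bilinear B" and "nondegenerate B" and "linear \<phi>"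
  obtains w where "\<And>z. B w z = \<phi> z"
proof -
  define A where "A w = (\<Sum>i\<in>Basis. B w i *\<^sub>R i)" for w
  have rep: "f z = (\<Sum>i\<in>Basis. f i *\<^sub>R i) \<bullet> z" if "linear f" for f :: "'a \<Rightarrow> real" and z
  proof -
    have "f z = f (\<Sum>i\<in>Basis. (z \<bullet> i) *\<^sub>R i)"
      by (simp add: euclidean_representation)
    also have "\<dots> = z \<bullet> (\<Sum>i\<in>Basis. f i *\<^sub>R i)"
      by (simp add: linear_sum[OF that] linear_scale[OF that] inner_sum_right mult.commute)
    finally show ?thesis
      by (simp only: inner_commute)
  qed
  have lB: "linear (B w)" "linear (\<lambda>w. B w z)" for w z
    using assms(1) by (auto simp: bilinear_def)
  have AB: "A w \<bullet> z = B w z" for w z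
    unfolding A_def by (rule rep[OF lB(1), symmetric])
  have "linear A"
    unfolding A_def
    by (rule linearI) (simp_all add: linear_add[OF lB(2)] linear_scale[OF lB(2)]
        scaleR_add_left sum.distrib scaleR_sum_right)
  moreover have "inj A"
    by (rule injI) (metis AB nondegenerate_eqI[OF assms(1,2)])
  ultimately have "surj A"
    by (rule linear_inj_imp_surj)
  then obtain w where "A w = (\<Sum>i\<in>Basis. \<phi> i *\<^sub>R i)"
    by (metis surjD)
  then have "B w z = \<phi> z" for z
    using AB[of w z] rep[OF assms(3), of z] by simp
  then show thesis
    by (rule that)
qed

text \<open>Pairing a combination of the \<open>E i\<close> with \<open>E j\<close> isolates its
  \<open>j\<close>-th coefficient. This gives independence, hence a basis by counting, and then
  shows that a vector in the radical has only zero coefficients.\<close>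

lemma nondegenerate_orthonormal:
  fixes B :: "'e::euclidean_space \<Rightarrow> 'e \<Rightarrow> real" and E :: "nat \<Rightarrow> 'e"
  assumes "bilinear B"
    and "\<And>i j. i < DIM('e) \<Longrightarrow> j < DIM('e) \<Longrightarrow> i \<noteq> j \<Longrightarrow> B (E i) (E j) = 0"
    and "\<And>i. i < DIM('e) \<Longrightarrow> B (E i) (E i) \<noteq> 0"
  shows "nondegenerate B"
proof -
  let ?I = "{..<DIM('e)}"
  have lB: "linear (\<lambda>w. B w z)" for z
    using assms(1) by (auto simp: bilinear_def)
  have comp: "B (\<Sum>i\<in>?I. r i *\<^sub>R E i) (E j) = r j * B (E j) (E j)" if "j < DIM('e)" for r j
  proof -
    have "B (\<Sum>i\<in>?I. r i *\<^sub>R E i) (E j) = (\<Sum>i\<in>?I. r i * B (E i) (E j))"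
      by (simp add: linear_sum[OF lB] linear_scale[OF lB])
    also have "\<dots> = (\<Sum>i\<in>?I. if i = j then r j * B (E j) (E j) else 0)"
      by (rule sum.cong) (use assms(2) that in auto)
    finally show ?thesis
      using that by simp
  qed
  \<comment> \<open>Equal vectors with different indices would give
    \<open>B (E i) (E i) = 0\<close>.\<close>
  have inj: "inj_on E ?I"
    by (rule inj_onI) (metis assms(2,3) lessThan_iff)
  have "independent (E ` ?I)"
  proof (rule independent_if_scalars_zero)
    fix f x assume "(\<Sum>x\<in>E ` ?I. f x *\<^sub>R x) = 0" and "x \<in> E ` ?I"
    then obtain j where j: "j < DIM('e)" "x = E j" and "(\<Sum>i\<in>?I. f (E i) *\<^sub>R E i) = 0"
      by (auto simp: sum.reindex[OF inj])
    then have "0 = f (E j) * B (E j) (E j)"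
      using comp[of j "\<lambda>i. f (E i)"] linear_0[OF lB] by simp
    then show "f x = 0"
      using assms(3) j by simp
  qed simp
  moreover have "card (E ` ?I) = DIM('e)"
    using inj by (simp add: card_image)
  ultimately have span: "span (E ` ?I) = UNIV"
    using card_eq_dim[of "E ` ?I" UNIV] by (simp add: dim_UNIV) blast
  show ?thesis
    unfolding nondegenerate_def
  proof (intro allI impI)
    fix w assume w: "\<forall>z. B w z = 0"
    have "w \<in> span (E ` ?I)"
      using span by simp
    then obtain f where "w = (\<Sum>x\<in>E ` ?I. f x *\<^sub>R x)"
      by (auto simp: span_finite)
    then have f: "w = (\<Sum>i\<in>?I. f (E i) *\<^sub>R E i)"
      by (simp add: sum.reindex[OF inj])
    have "f (E j) = 0" if "j < DIM('e)" for j
      using comp[OF that, of "\<lambda>i. f (E i)"] w assms(3)[OF that] by (simp flip: f)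
    then show "w = 0"
      using f by simp
  qed
qed

section \<open>Torsion-free metric connections as linear algebra at one point\<close>

text \<open>\<open>B\<close> stands for the metric at a point and \<open>D a b b'\<close> for the
  derivative in direction \<open>a\<close> of the metric on the constant fields \<open>b\<close> and
  \<open>b'\<close>. The body mirrors the description inside \<open>levi_civita\<close>, with the
  analysis hidden in \<open>D\<close>.\<close>

definition metric_connection ::
  "('e::euclidean_space \<Rightarrow> 'e \<Rightarrow> real) \<Rightarrow> ('e \<Rightarrow> 'e \<Rightarrow> 'e \<Rightarrow> real) \<Rightarrow> ('e \<Rightarrow> 'e \<Rightarrow> 'e) \<Rightarrow> bool" where
  "metric_connection B D \<Gamma> \<longleftrightarrow> bilinear \<Gamma> \<and> (\<forall>a b. \<Gamma> a b = \<Gamma> b a) \<and>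
     (\<forall>a b b'. D a b b' = B (\<Gamma> a b) b' + B b (\<Gamma> a b'))"

text \<open>The Koszul formula: compatibility is used for three arrangements of the arguments, and
  symmetry of \<open>\<Gamma>\<close> cancels all terms except two copies of the left side.\<close>

lemma metric_connection_koszul:
  assumes "\<And>a b. B a b = B b a" and "metric_connection B D \<Gamma>"
  shows "B (\<Gamma> a b) z = (D a b z + D b a z - D z a b) / 2"
proof -
  have sym: "\<Gamma> a b = \<Gamma> b a" for a b
    using assms(2) by (simp add: metric_connection_def)
  have D: "D a b b' = B (\<Gamma> a b) b' + B b (\<Gamma> a b')" for a b b'
    using assms(2) by (simp add: metric_connection_def)
  show ?thesis
    unfolding D using assms(1) sym[of a b] sym[of z a] sym[of z b] by (simp add: assms(1))
qed

lemma metric_connection_unique: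
  assumes "bilinear B" and "nondegenerate B" and "\<And>a b. B a b = B b a"
    and "metric_connection B D \<Gamma>" and "metric_connection B D \<Gamma>'"
  shows "\<Gamma> = \<Gamma>'"
proof (intro ext)
  fix a b
  show "\<Gamma> a b = \<Gamma>' a b"
    by (rule nondegenerate_eqI[OF assms(1,2)])
      (simp add: metric_connection_koszul[OF assms(3,4)] metric_connection_koszul[OF assms(3,5)])
qed

text \<open>The Koszul expression \<open>K a b\<close> is linear in its last argument, so
  \<open>B\<close> represents it by a vector, which is taken as \<open>\<Gamma> a b\<close>. Its
  bilinearity and symmetry are read off from \<open>K\<close> by nondegeneracy.\<close>

lemma metric_connection_exists:
  assumes "bilinear B" and "nondegenerate B" and "\<And>a b. B a b = B b a"
    and "\<And>b b'. linear (\<lambda>a. D a b b')" and "\<And>a b'. linear (\<lambda>b. D a b b')"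
    and "\<And>a b b'. D a b b' = D a b' b"
  obtains \<Gamma> where "metric_connection B D \<Gamma>"
proof -
  define K where "K a b z = (D a b z + D b a z - D z a b) / 2" for a b z
  have lin3: "linear (\<lambda>b'. D a b b')" for a b
    using assms(5)[of a b] by (simp add: assms(6)[of a b])
  note D_simps = linear_add[OF assms(4)] linear_add[OF assms(5)] linear_add[OF lin3]
    linear_scale[OF assms(4)] linear_scale[OF assms(5)] linear_scale[OF lin3]
  have "linear (K a b)" for a b
    by (rule linearI) (simp_all add: K_def D_simps field_simps)
  then have "\<exists>w. \<forall>z. B w z = K a b z" for a b
    using nondegenerate_represents[OF assms(1,2), of "K a b"] by metis
  then obtain \<Gamma> where \<Gamma>: "\<And>a b z. B (\<Gamma> a b) z = K a b z"
    by metis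
  have sym: "\<Gamma> a b = \<Gamma> b a" for a b
    by (rule nondegenerate_eqI[OF assms(1,2)]) (simp add: \<Gamma> K_def assms(6)[of _ a b])
  have "linear (\<Gamma> a)" for a
    by (rule linearI; rule nondegenerate_eqI[OF assms(1,2)])
      (simp_all add: \<Gamma> bilinear_ladd[OF assms(1)] bilinear_lmul[OF assms(1)] K_def D_simps field_simps)
  then have "bilinear \<Gamma>"
    unfolding bilinear_def by (simp add: sym[of _ b for b])
  \<comment> \<open>In \<open>K a b b' + K a b' b\<close> the terms differentiated along
    \<open>b\<close> and \<open>b'\<close> cancel, by symmetry of \<open>D\<close> in its last two
    arguments.\<close>
  moreover have "D a b b' = B (\<Gamma> a b) b' + B b (\<Gamma> a b')" for a b b'
    unfolding assms(3)[of b] \<Gamma> K_def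
    using assms(6)[of a b b'] assms(6)[of b a b'] assms(6)[of b' a b] by argo
  ultimately have "metric_connection B D \<Gamma>"
    using sym by (auto simp: metric_connection_def)
  then show thesis
    by (rule that)
qed

text \<open>\<open>du\<close> stands for the differential of \<open>u\<close>, \<open>G\<close> for its gradient and \<open>E\<close> for \<open>e\<^sup>2\<^sup>u\<close>.\<close>

lemma metric_connection_conformal:
  fixes B :: "'e::euclidean_space \<Rightarrow> 'e \<Rightarrow> real"
  assumes "bilinear B" and "\<And>a b. B a b = B b a" and "linear du" and "\<And>z. B G z = du z"
    and "metric_connection B D \<Gamma>"
  shows "metric_connection (\<lambda>a b. E * B a b) (\<lambda>a b b'. E * (2 * du a * B b b' + D a b b'))
    (\<lambda>a b. \<Gamma> a b + du a *\<^sub>R b + du b *\<^sub>R a - B a b *\<^sub>R G)"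
proof -
  note B_simps = bilinear_ladd[OF assms(1)] bilinear_radd[OF assms(1)] bilinear_lmul[OF assms(1)]
    bilinear_rmul[OF assms(1)] bilinear_lsub[OF assms(1)] bilinear_rsub[OF assms(1)]
  have \<Gamma>: "bilinear \<Gamma>" "\<Gamma> a b = \<Gamma> b a" "D a b b' = B (\<Gamma> a b) b' + B b (\<Gamma> a b')" for a b b'
    using assms(5) by (auto simp: metric_connection_def)
  note du_simps = linear_add[OF assms(3)] linear_scale[OF assms(3)]
  note \<Gamma>_simps = bilinear_ladd[OF \<Gamma>(1)] bilinear_radd[OF \<Gamma>(1)] bilinear_lmul[OF \<Gamma>(1)] bilinear_rmul[OF \<Gamma>(1)]
  show ?thesis
    unfolding metric_connection_def
  proof (intro conjI allI)
    show "bilinear (\<lambda>a b. \<Gamma> a b + du a *\<^sub>R b + du b *\<^sub>R a - B a b *\<^sub>R G)"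
      unfolding bilinear_def
      by (intro conjI allI linearI) (simp_all add: \<Gamma>_simps B_simps du_simps algebra_simps)
  next
    fix a b
    show "\<Gamma> a b + du a *\<^sub>R b + du b *\<^sub>R a - B a b *\<^sub>R G = \<Gamma> b a + du b *\<^sub>R a + du a *\<^sub>R b - B b a *\<^sub>R G"
      using \<Gamma>(2)[of a b] assms(2)[of a b] by simp
  next
    fix a b b'
    have "B b G = du b"
      using assms(2,4) by metis
    \<comment> \<open>The \<open>du b\<close> and \<open>du b'\<close> terms cancel against the two
      gradient terms; the two \<open>du a\<close> terms add up to the factor 2 that comes from
      differentiating the conformal factor.\<close>
    then show "E * (2 * du a * B b b' + D a b b')
        = E * B (\<Gamma> a b + du a *\<^sub>R b + du b *\<^sub>R a - B a b *\<^sub>R G) b'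
        + E * B b (\<Gamma> a b' + du a *\<^sub>R b' + du b' *\<^sub>R a - B a b' *\<^sub>R G)"
      using assms(2)[of b a] by (simp add: B_simps \<Gamma>(3) assms(4) algebra_simps)
  qed
qed


section \<open>Charts and tangent vectors\<close>

lemma charts_at_iff: "c \<in> charts_at M p \<longleftrightarrow> c \<in> charts M \<and> p \<in> cdom c"
  by (simp add: charts_at_def)

lemma chart_at_in_charts_at:
  assumes "smooth_manifold M" and "p \<in> points M"
  shows "chart_at M p \<in> charts_at M p"
proof -
  have "p \<in> \<Union> (cdom ` charts M)"
    using assms by (simp add: smooth_manifold_def)
  then have "\<exists>c. c \<in> charts_at M p"
    by (auto simp: charts_at_iff)
  then show ?thesis
    unfolding chart_at_def by (rule someI_ex)
qed

lemma
  assumes "smooth_manifold M" and "c \<in> charts M"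
  shows cdom_subset: "cdom c \<subseteq> points M"
    and openin_cdom: "openin (mtop M) (cdom c)"
    and open_cimage: "open (cimage c)"
    and homeomorphic_cmap: "homeomorphic_map (subtopology (mtop M) (cdom c)) (top_of_set (cimage c)) (cmap c)"
  using assms openin_subset unfolding smooth_manifold_def by blast+

lemma inj_on_cmap:
  assumes "smooth_manifold M" and "c \<in> charts M"
  shows "inj_on (cmap c) (cdom c)"
  using homeomorphic_imp_injective_map[OF homeomorphic_cmap[OF assms]] cdom_subset[OF assms]
  by (simp add: inf_absorb2)

lemma cinv_cmap:
  assumes "smooth_manifold M" and "c \<in> charts M" and "p \<in> cdom c"
  shows "cinv c (cmap c p) = p"
  unfolding cinv_def using inj_on_cmap[OF assms(1,2)] assms(3) by (rule inv_into_f_f)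

lemma open_cmap_image:
  assumes "smooth_manifold M" and "c \<in> charts M" and "openin (mtop M) U"
  shows "open (cmap c ` (cdom c \<inter> U))"
proof -
  have "openin (subtopology (mtop M) (cdom c)) (cdom c \<inter> U)"
    using assms(3) by (auto simp: openin_subtopology)
  then have "openin (top_of_set (cimage c)) (cmap c ` (cdom c \<inter> U))"
    using homeomorphic_imp_open_map[OF homeomorphic_cmap[OF assms(1,2)]] by (auto simp: open_map_def)
  then show ?thesis
    using open_cimage[OF assms(1,2)] by (rule openin_open_trans)
qed

lemma eventually_chart:
  assumes "smooth_manifold M" and "c \<in> charts_at M p" and "openin (mtop M) U" and "p \<in> U"
  shows "\<forall>\<^sub>F y in nhds (cmap c p). cinv c y \<in> cdom c \<inter> U \<and> cmap c (cinv c y) = y"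
proof -
  have c: "c \<in> charts M" "p \<in> cdom c"
    using assms(2) by (auto simp: charts_at_iff)
  have "\<forall>\<^sub>F y in nhds (cmap c p). y \<in> cmap c ` (cdom c \<inter> U)"
    using open_cmap_image[OF assms(1) c(1) assms(3)] c(2) assms(4) by (intro eventually_nhds_in_open) auto
  then show ?thesis
    by (rule eventually_mono) (use cinv_cmap[OF assms(1) c(1)] in auto)
qed

lemma differentiable_transition:
  assumes "smooth_manifold M" and "c \<in> charts_at M p" and "c' \<in> charts_at M p"
  shows "(cmap c' \<circ> cinv c) differentiable at (cmap c p)"
proof -
  have "smooth_on (cmap c ` (cdom c \<inter> cdom c')) (cmap c' \<circ> cinv c)"
    using assms by (simp add: smooth_manifold_def charts_at_iff)
  then show ?thesis
    by (rule smooth_on_differentiable) (use assms in \<open>auto simp: charts_at_iff\<close>)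
qed

text \<open>The cocycle identity of coordinate changes, from the chain rule on the overlap. It is
  what makes \<open>coord_vec\<close> a tangent vector.\<close>

lemma frechet_derivative_transition:
  assumes "smooth_manifold M" and "c \<in> charts_at M p" and "c' \<in> charts_at M p" and "c'' \<in> charts_at M p"
  shows "frechet_derivative (cmap c'' \<circ> cinv c') (at (cmap c' p))
      (frechet_derivative (cmap c' \<circ> cinv c) (at (cmap c p)) a)
    = frechet_derivative (cmap c'' \<circ> cinv c) (at (cmap c p)) a"
proof -
  have c: "c \<in> charts M" "p \<in> cdom c" and c': "c' \<in> charts M" "p \<in> cdom c'"
    using assms by (auto simp: charts_at_iff)
  have p: "(cmap c' \<circ> cinv c) (cmap c p) = cmap c' p"
    by (simp add: cinv_cmap[OF assms(1) c])
  have "\<forall>\<^sub>F y in nhds (cmap c p). cinv c y \<in> cdom c \<inter> cdom c' \<and> cmap c (cinv c y) = y"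
    using eventually_chart[OF assms(1,2) openin_cdom[OF assms(1) c'(1)] c'(2)] .
  then have ev: "\<forall>\<^sub>F y in nhds (cmap c p). (cmap c'' \<circ> cinv c) y
      = (cmap c'' \<circ> cinv c') ((cmap c' \<circ> cinv c) y)"
    by (rule eventually_mono) (simp add: cinv_cmap[OF assms(1) c'(1)])
  have "(cmap c'' \<circ> cinv c') differentiable at ((cmap c' \<circ> cinv c) (cmap c p))"
    unfolding p by (rule differentiable_transition[OF assms(1,3,4)])
  from has_derivative_compose_eventually[OF differentiable_transition[OF assms(1-3)] this ev]
  show ?thesis
    unfolding p by (rule frechet_derivative_eqI[symmetric])
qed

lemma coord_vec_self:
  assumes "smooth_manifold M" and "c \<in> charts_at M p"
  shows "coord_vec M c p a c = a"
proof -
  have c: "c \<in> charts M" "p \<in> cdom c"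
    using assms by (auto simp: charts_at_iff)
  have "frechet_derivative (cmap c \<circ> cinv c) (at (cmap c p)) = frechet_derivative (\<lambda>y. y) (at (cmap c p))"
    by (rule frechet_derivative_cong_open(1)[OF open_cimage[OF assms(1) c(1)]])
      (use c cinv_cmap[OF assms(1) c(1)] in auto)
  then show ?thesis
    using assms(2) by (simp add: coord_vec_def)
qed

lemma coord_vec_tangent:
  assumes "smooth_manifold M" and "c \<in> charts_at M p"
  shows "coord_vec M c p a \<in> tangent_space M p"
  using frechet_derivative_transition[OF assms]
  by (auto simp: tangent_space_def coord_vec_def)

lemma coord_vec_component:
  assumes "v \<in> tangent_space M p" and "c \<in> charts_at M p"
  shows "coord_vec M c p (v c) = v"
proof
  fix c'
  \<comment> \<open>In charts not around \<open>p\<close> both vectors have the default component 0,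
    so they agree as functions on all charts.\<close>
  have "v c' = (if c' \<in> charts_at M p
      then frechet_derivative (cmap c' \<circ> cinv c) (at (cmap c p)) (v c) else 0)"
    using assms unfolding tangent_space_def mem_Collect_eq by (metis (no_types, lifting))
  then show "coord_vec M c p (v c) c' = v c'"
    by (simp only: coord_vec_def)
qed

lemma coord_vec_lincomb:
  assumes "smooth_manifold M" and "c \<in> charts_at M p"
  shows "coord_vec M c p (r *\<^sub>R a + b) = (\<lambda>c'. r *\<^sub>R coord_vec M c p a c' + coord_vec M c p b c')"
proof
  fix c'
  show "coord_vec M c p (r *\<^sub>R a + b) c' = r *\<^sub>R coord_vec M c p a c' + coord_vec M c p b c'"
  proof (cases "c' \<in> charts_at M p")
    case True
    have lin: "linear (frechet_derivative (cmap c' \<circ> cinv c) (at (cmap c p)))"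
      by (rule linear_frechet_derivative[OF differentiable_transition[OF assms True]])
    then show ?thesis
      using True by (simp add: coord_vec_def linear_add[OF lin] linear_scale[OF lin])
  qed (simp add: coord_vec_def)
qed

lemma coord_vec_scale:
  assumes "smooth_manifold M" and "c \<in> charts_at M p"
  shows "coord_vec M c p (r *\<^sub>R a) = (\<lambda>c'. r *\<^sub>R coord_vec M c p a c')"
proof -
  have "coord_vec M c p 0 c' = 0" for c'
    using fun_cong[OF coord_vec_lincomb[OF assms, of 1 0 0]] by simp
  then show ?thesis
    using coord_vec_lincomb[OF assms, of r a 0] by simp
qed

lemma tangent_space_lincomb:
  assumes "smooth_manifold M" and "p \<in> points M"
    and "v \<in> tangent_space M p" and "w \<in> tangent_space M p"
  shows "(\<lambda>c. r *\<^sub>R v c + w c) \<in> tangent_space M p"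
proof -
  define c where "c = chart_at M p"
  have c: "c \<in> charts_at M p"
    unfolding c_def by (rule chart_at_in_charts_at[OF assms(1,2)])
  have "coord_vec M c p (r *\<^sub>R v c + w c) = (\<lambda>c. r *\<^sub>R v c + w c)"
    by (simp add: coord_vec_lincomb[OF assms(1) c] coord_vec_component[OF assms(3) c]
        coord_vec_component[OF assms(4) c])
  then show ?thesis
    using coord_vec_tangent[OF assms(1) c] by metis
qed

lemma tangent_space_zero:
  assumes "smooth_manifold M"
  shows "(\<lambda>_. 0) \<in> tangent_space M p"
proof -
  have "frechet_derivative (cmap c' \<circ> cinv c) (at (cmap c p)) 0 = 0"
    if "c \<in> charts_at M p" "c' \<in> charts_at M p" for c c'
    by (rule linear_0[OF linear_frechet_derivative[OF differentiable_transition[OF assms that]]])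
  then show ?thesis
    by (simp add: tangent_space_def)
qed

lemma tangent_space_scale:
  assumes "smooth_manifold M" and "p \<in> points M" and "v \<in> tangent_space M p"
  shows "(\<lambda>c. r *\<^sub>R v c) \<in> tangent_space M p"
  using tangent_space_lincomb[OF assms tangent_space_zero[OF assms(1)]] by simp


section \<open>Differentials\<close>

lemma smooth_map_point:
  assumes "smooth_map S M \<psi>" and "s \<in> points S"
  shows "\<psi> s \<in> points M"
  using assms unfolding smooth_map_def by (meson continuous_map_funspace funcset_mem PiE)

lemma openin_vimage_cdom:
  assumes "smooth_manifold M" and "smooth_map S M \<psi>" and "c \<in> charts M"
  shows "openin (mtop S) {s \<in> points S. \<psi> s \<in> cdom c}"
  using assms(2) openin_cdom[OF assms(1,3)]
  unfolding smooth_map_def by (blast intro: openin_continuous_map_preimage)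

lemma eventually_chart_vimage:
  assumes "smooth_manifold S" and "smooth_manifold M" and "smooth_map S M \<psi>"
    and "d \<in> charts_at S s" and "c \<in> charts_at M (\<psi> s)"
  shows "\<forall>\<^sub>F y in nhds (cmap d s). cinv c (cmap c (\<psi> (cinv d y))) = \<psi> (cinv d y)"
proof -
  have c: "c \<in> charts M" "\<psi> s \<in> cdom c"
    using assms by (auto simp: charts_at_iff)
  have "s \<in> points S"
    using assms(1,4) cdom_subset unfolding charts_at_iff by blast
  then have "\<forall>\<^sub>F y in nhds (cmap d s). cinv d y \<in> cdom d \<inter> {s \<in> points S. \<psi> s \<in> cdom c}
      \<and> cmap d (cinv d y) = y"
    using c by (intro eventually_chart[OF assms(1,4) openin_vimage_cdom[OF assms(2,3)]]) auto
  then show ?thesis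
    by (rule eventually_mono) (use cinv_cmap[OF assms(2) c(1)] in auto)
qed

lemma differentiable_local_map:
  assumes "smooth_map S M \<psi>" and "d \<in> charts_at S s" and "c \<in> charts_at M (\<psi> s)"
  shows "(cmap c \<circ> \<psi> \<circ> cinv d) differentiable at (cmap d s)"
proof -
  have "smooth_on (cmap d ` (cdom d \<inter> \<psi> -` cdom c)) (cmap c \<circ> \<psi> \<circ> cinv d)"
    using assms by (simp add: smooth_map_def charts_at_iff)
  then show ?thesis
    by (rule smooth_on_differentiable) (use assms in \<open>auto simp: charts_at_iff\<close>)
qed

lemma differential_tangent:
  assumes "smooth_manifold S" and "smooth_manifold M" and "smooth_map S M \<psi>" and "s \<in> points S"
  shows "differential S M \<psi> s v \<in> tangent_space M (\<psi> s)"
proof -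
  define d where "d = chart_at S s"
  have d: "d \<in> charts_at S s"
    unfolding d_def by (rule chart_at_in_charts_at[OF assms(1,4)])
  have "frechet_derivative (cmap c' \<circ> cinv c) (at (cmap c (\<psi> s)))
      (frechet_derivative (cmap c \<circ> \<psi> \<circ> cinv d) (at (cmap d s)) a)
    = frechet_derivative (cmap c' \<circ> \<psi> \<circ> cinv d) (at (cmap d s)) a"
    if c: "c \<in> charts_at M (\<psi> s)" and c': "c' \<in> charts_at M (\<psi> s)" for c c' a
  proof -
    have s: "(cmap c \<circ> \<psi> \<circ> cinv d) (cmap d s) = cmap c (\<psi> s)"
      using d cinv_cmap[OF assms(1)] by (simp add: charts_at_iff)
    have ev: "\<forall>\<^sub>F y in nhds (cmap d s). (cmap c' \<circ> \<psi> \<circ> cinv d) y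
        = (cmap c' \<circ> cinv c) ((cmap c \<circ> \<psi> \<circ> cinv d) y)"
      using eventually_chart_vimage[OF assms(1-3) d c] by (rule eventually_mono) simp
    have "(cmap c' \<circ> cinv c) differentiable at ((cmap c \<circ> \<psi> \<circ> cinv d) (cmap d s))"
      unfolding s by (rule differentiable_transition[OF assms(2) c c'])
    from has_derivative_compose_eventually[OF differentiable_local_map[OF assms(3) d c] this ev]
    show ?thesis
      unfolding s by (rule frechet_derivative_eqI[symmetric])
  qed
  then show ?thesis
    by (simp add: tangent_space_def differential_def Let_def flip: d_def)
qed

lemma differential_lincomb:
  assumes "smooth_manifold S" and "smooth_map S M \<psi>" and "s \<in> points S"
  shows "differential S M \<psi> s (\<lambda>d. r *\<^sub>R v d + w d)
    = (\<lambda>c. r *\<^sub>R differential S M \<psi> s v c + differential S M \<psi> s w c)"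
proof
  fix c
  define d where "d = chart_at S s"
  have d: "d \<in> charts_at S s"
    unfolding d_def by (rule chart_at_in_charts_at[OF assms(1,3)])
  show "differential S M \<psi> s (\<lambda>d. r *\<^sub>R v d + w d) c
    = r *\<^sub>R differential S M \<psi> s v c + differential S M \<psi> s w c"
  proof (cases "c \<in> charts_at M (\<psi> s)")
    case True
    have lin: "linear (frechet_derivative (cmap c \<circ> \<psi> \<circ> cinv d) (at (cmap d s)))"
      by (rule linear_frechet_derivative[OF differentiable_local_map[OF assms(2) d True]])
    then show ?thesis
      using True by (simp add: differential_def Let_def linear_add[OF lin] linear_scale[OF lin] flip: d_def)
  qed (simp add: differential_def)
qed

lemma differential_scale:
  assumes "smooth_manifold S" and "smooth_map S M \<psi>" and "s \<in> points S"
  shows "differential S M \<psi> s (\<lambda>d. r *\<^sub>R v d) = (\<lambda>c. r *\<^sub>R differential S M \<psi> s v c)"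
proof -
  have "differential S M \<psi> s (\<lambda>_. 0) c = 0" for c
    using fun_cong[OF differential_lincomb[OF assms, of 1 "\<lambda>_. 0" "\<lambda>_. 0"]] by simp
  then show ?thesis
    using differential_lincomb[OF assms, of r v "\<lambda>_. 0"] by simp
qed

text \<open>The rule \<open>d(f o \<psi>) = df o d\<psi>\<close> in coordinates, using the chart of
  S that \<open>differential\<close> and \<open>covariant_derivative\<close> select.\<close>

lemma has_derivative_compose_map:
  fixes f :: "'a \<Rightarrow> real"
  assumes "smooth_manifold S" and "smooth_manifold M" and "smooth_map S M \<psi>" and "s \<in> points S"
    and "smooth_fun M f" and "c \<in> charts_at M (\<psi> s)"
  shows "((\<lambda>y. f (\<psi> (cinv (chart_at S s) y))) has_derivative
      (\<lambda>a. frechet_derivative (f \<circ> cinv c) (at (cmap c (\<psi> s)))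
        (frechet_derivative (cmap c \<circ> \<psi> \<circ> cinv (chart_at S s)) (at (cmap (chart_at S s) s)) a)))
      (at (cmap (chart_at S s) s))"
proof -
  define d where "d = chart_at S s"
  have d: "d \<in> charts_at S s"
    unfolding d_def by (rule chart_at_in_charts_at[OF assms(1,4)])
  have s: "(cmap c \<circ> \<psi> \<circ> cinv d) (cmap d s) = cmap c (\<psi> s)"
    using d cinv_cmap[OF assms(1)] by (simp add: charts_at_iff)
  have ev: "\<forall>\<^sub>F y in nhds (cmap d s). f (\<psi> (cinv d y)) = (f \<circ> cinv c) ((cmap c \<circ> \<psi> \<circ> cinv d) y)"
    using eventually_chart_vimage[OF assms(1-3) d assms(6)] by (rule eventually_mono) simp
  have "(f \<circ> cinv c) differentiable at ((cmap c \<circ> \<psi> \<circ> cinv d) (cmap d s))"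
    unfolding s by (rule smooth_on_differentiable[of "cimage c"])
      (use assms(5,6) in \<open>auto simp: smooth_fun_def charts_at_iff\<close>)
  from has_derivative_compose_eventually[OF differentiable_local_map[OF assms(3) d assms(6)] this ev, unfolded s]
  show ?thesis
    unfolding d_def .
qed

section \<open>Smooth functions: products, exponentials and pullbacks\<close>

lemma smooth_fun_mult:
  assumes "smooth_manifold M" and "smooth_fun M f" and "smooth_fun M h"
  shows "smooth_fun M (\<lambda>p. f p * h p)"
  using assms Ck_on_mult[OF open_cimage[OF assms(1)]]
  by (auto simp: smooth_fun_def smooth_on_def o_def)

lemma smooth_fun_exp:
  assumes "smooth_manifold M" and "smooth_fun M f"
  shows "smooth_fun M (\<lambda>p. exp (r * f p))"
  using assms Ck_on_exp[OF open_cimage[OF assms(1)]]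
  by (auto simp: smooth_fun_def smooth_on_def o_def)

lemma smooth_fun_compose:
  assumes "smooth_manifold S" and "smooth_manifold M" and "smooth_map S M \<psi>" and "smooth_fun M f"
  shows "smooth_fun S (\<lambda>s. f (\<psi> s))"
  unfolding smooth_fun_def smooth_on_def
proof (intro ballI allI)
  fix d k assume d: "d \<in> charts S"
  show "Ck_on k (cimage d) ((\<lambda>s. f (\<psi> s)) \<circ> cinv d)"
  \<comment> \<open>The image of a chart domain of S may spread over several charts of M, so the
    composition in coordinates is available only on a neighbourhood of each point.\<close>
  proof (rule Ck_on_local)
    fix x assume "x \<in> cimage d"
    then obtain s where s: "s \<in> cdom d" "x = cmap d s"
      by auto
    then have sS: "s \<in> points S"
      using cdom_subset[OF assms(1) d] by blast
    have "chart_at M (\<psi> s) \<in> charts_at M (\<psi> s)"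
      by (rule chart_at_in_charts_at[OF assms(2) smooth_map_point[OF assms(3) sS]])
    then obtain c where c: "c \<in> charts M" "\<psi> s \<in> cdom c"
      unfolding charts_at_iff by blast
    define V where "V = cmap d ` (cdom d \<inter> {s \<in> points S. \<psi> s \<in> cdom c})"
    have V: "open V" "x \<in> V"
      unfolding V_def using open_cmap_image[OF assms(1) d openin_vimage_cdom[OF assms(2,3) c(1)]] s sS c by auto
    have "Ck_on k (cmap d ` (cdom d \<inter> \<psi> -` cdom c)) (cmap c \<circ> \<psi> \<circ> cinv d)"
      using assms(3) c d by (auto simp: smooth_map_def smooth_on_def)
    then have g: "Ck_on k V (cmap c \<circ> \<psi> \<circ> cinv d)"
      by (rule Ck_on_subset) (auto simp: V_def)
    have f: "Ck_on k (cimage c) (f \<circ> cinv c)"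
      using assms(4) c by (auto simp: smooth_fun_def smooth_on_def)
    have img: "(cmap c \<circ> \<psi> \<circ> cinv d) ` V \<subseteq> cimage c"
      using cinv_cmap[OF assms(1) d] by (auto simp: V_def)
    have "Ck_on k V ((\<lambda>s. f (\<psi> s)) \<circ> cinv d)"
      by (rule Ck_on_cong[OF V(1) _ Ck_on_compose[OF V(1) img f g]])
        (use cinv_cmap[OF assms(1) d] cinv_cmap[OF assms(2) c(1)] in \<open>auto simp: V_def\<close>)
    then show "\<exists>V. open V \<and> x \<in> V \<and> Ck_on k V ((\<lambda>s. f (\<psi> s)) \<circ> cinv d)"
      using V by blast
  qed
qed


section \<open>Metrics and their Levi-Civita connections\<close>

lemma form_sym:
  assumes "smooth_symmetric_form M g" and "p \<in> points M"
    and "v \<in> tangent_space M p" and "w \<in> tangent_space M p"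
  shows "g p v w = g p w v"
  using assms by (simp add: smooth_symmetric_form_def)

lemma form_lincomb_left:
  assumes "smooth_symmetric_form M g" and "p \<in> points M"
    and "v \<in> tangent_space M p" and "w \<in> tangent_space M p" and "z \<in> tangent_space M p"
  shows "g p (\<lambda>c. r *\<^sub>R v c + w c) z = r * g p v z + g p w z"
  using assms by (simp add: smooth_symmetric_form_def)

lemma form_lincomb_right:
  assumes "smooth_manifold M" and "smooth_symmetric_form M g" and "p \<in> points M"
    and "v \<in> tangent_space M p" and "w \<in> tangent_space M p" and "z \<in> tangent_space M p"
  shows "g p z (\<lambda>c. r *\<^sub>R v c + w c) = r * g p z v + g p z w"
  using form_lincomb_left[OF assms(2-6)] form_sym[OF assms(2,3,6)] assms
    tangent_space_lincomb[OF assms(1,3-5)] by metis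

lemma form_scale_left:
  assumes "smooth_manifold M" and "smooth_symmetric_form M g" and "p \<in> points M"
    and "v \<in> tangent_space M p" and "z \<in> tangent_space M p"
  shows "g p (\<lambda>c. r *\<^sub>R v c) z = r * g p v z"
proof -
  note zero = tangent_space_zero[OF assms(1), of p]
  have "g p (\<lambda>_. 0) z = 0"
    using form_lincomb_left[OF assms(2,3) zero zero assms(5), of 1] by simp
  then show ?thesis
    using form_lincomb_left[OF assms(2,3,4) zero assms(5), of r] by simp
qed

text \<open>Matches \<open>smooth_symmetric_form\<close>, which packs additivity and homogeneity
  into one identity.\<close>

lemma linearI_lincomb:
  fixes f :: "'e::real_vector \<Rightarrow> real"
  assumes "\<And>r a b. f (r *\<^sub>R a + b) = r * f a + f b"
  shows "linear f"
proof (rule linearI)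
  show "f (a + b) = f a + f b" for a b
    using assms[of 1 a b] by simp
  have "f 0 = 0"
    using assms[of 1 0 0] by simp
  then show "f (r *\<^sub>R a) = r *\<^sub>R f a" for r a
    using assms[of r a 0] by simp
qed

lemma bilinearI_lincomb:
  fixes B :: "'e::real_vector \<Rightarrow> 'f::real_vector \<Rightarrow> real"
  assumes "\<And>r a b z. B (r *\<^sub>R a + b) z = r * B a z + B b z"
    and "\<And>r a b z. B z (r *\<^sub>R a + b) = r * B z a + B z b"
  shows "bilinear B"
  unfolding bilinear_def
  by (intro conjI allI linearI_lincomb) (rule assms)+

lemma metric_comp_cmap:
  assumes "smooth_manifold M" and "c \<in> charts_at M p"
  shows "metric_comp M g c (cmap c p) a b = g p (coord_vec M c p a) (coord_vec M c p b)"
  using assms cinv_cmap[OF assms(1)] by (simp add: metric_comp_def charts_at_iff Let_def)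

lemma
  assumes "smooth_manifold M" and "smooth_symmetric_form M g" and "x \<in> cimage c" and "c \<in> charts M"
  shows bilinear_metric_comp: "bilinear (metric_comp M g c x)"
    and metric_comp_sym: "metric_comp M g c x a b = metric_comp M g c x b a"
proof -
  obtain p where x: "x = cmap c p" and c: "c \<in> charts_at M p"
    using assms(3,4) by (auto simp: charts_at_iff)
  have p: "p \<in> points M"
    using c cdom_subset[OF assms(1,4)] by (auto simp: charts_at_iff)
  note t = coord_vec_tangent[OF assms(1) c]
  show "bilinear (metric_comp M g c x)"
    unfolding x
    by (rule bilinearI_lincomb)
      (simp_all add: metric_comp_cmap[OF assms(1) c] coord_vec_lincomb[OF assms(1) c] t
        form_lincomb_left[OF assms(2) p t t t] form_lincomb_right[OF assms(1,2) p t t t])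
  show "metric_comp M g c x a b = metric_comp M g c x b a"
    unfolding x metric_comp_cmap[OF assms(1) c] by (rule form_sym[OF assms(2) p t t])
qed

text \<open>Taking components in \<open>c\<close> carries an orthonormal frame of the tangent space
  to vectors of the model space with the same products.\<close>

lemma nondegenerate_metric_comp:
  fixes M :: "('a, 'e::euclidean_space) manifold"
  assumes "smooth_manifold M" and "lorentzian_metric M g" and "p \<in> points M" and "c \<in> charts_at M p"
  shows "nondegenerate (metric_comp M g c (cmap c p))"
proof -
  have "\<exists>E :: nat \<Rightarrow> ('a, 'e) tvec. (\<forall>i<DIM('e). E i \<in> tangent_space M p) \<and>
      (\<forall>i<DIM('e). \<forall>j<DIM('e). g p (E i) (E j) = (if i \<noteq> j then 0 else if i = 0 then - 1 else 1))"
    using assms(2,3) by (simp add: lorentzian_metric_def)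
  then obtain E :: "nat \<Rightarrow> ('a, 'e) tvec"
    where E: "\<forall>i<DIM('e). E i \<in> tangent_space M p"
      and gE: "\<forall>i<DIM('e). \<forall>j<DIM('e). g p (E i) (E j) = (if i \<noteq> j then 0 else if i = 0 then - 1 else 1)"
    by (elim exE conjE)
  have "metric_comp M g c (cmap c p) (E i c) (E j c) = g p (E i) (E j)" if "i < DIM('e)" "j < DIM('e)" for i j
    by (simp add: metric_comp_cmap[OF assms(1,4)] coord_vec_component[OF E[rule_format, OF that(1)] assms(4)]
        coord_vec_component[OF E[rule_format, OF that(2)] assms(4)])
  moreover have "bilinear (metric_comp M g c (cmap c p))"
    using assms by (intro bilinear_metric_comp) (auto simp: lorentzian_metric_def charts_at_iff)
  ultimately show ?thesis
    by (intro nondegenerate_orthonormal[where E = "\<lambda>i. E i c"]) (auto simp: gE)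
qed

lemma differentiable_metric_comp:
  assumes "smooth_symmetric_form M g" and "c \<in> charts_at M p"
  shows "(\<lambda>y. metric_comp M g c y a b) differentiable at (cmap c p)"
  by (rule smooth_on_differentiable[of "cimage c"])
    (use assms in \<open>auto simp: smooth_symmetric_form_def charts_at_iff\<close>)

text \<open>Unique existence, shown pointwise above, turns the definite description into usable
  properties.\<close>

lemma metric_connection_levi_civita:
  assumes "smooth_manifold M" and "lorentzian_metric M g" and "p \<in> points M" and "c \<in> charts_at M p"
  shows "metric_connection (metric_comp M g c (cmap c p))
    (\<lambda>a b b'. frechet_derivative (\<lambda>y. metric_comp M g c y b b') (at (cmap c p)) a)
    (levi_civita M g c (cmap c p))"
proof -
  have g: "smooth_symmetric_form M g"
    using assms(2) by (simp add: lorentzian_metric_def)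
  have c: "c \<in> charts M" "cmap c p \<in> cimage c"
    using assms(4) by (auto simp: charts_at_iff)
  note bil = bilinear_metric_comp[OF assms(1) g c(2,1)]
  note sym = metric_comp_sym[OF assms(1) g c(2,1)]
  note nd = nondegenerate_metric_comp[OF assms]
  define D where "D a b b' = frechet_derivative (\<lambda>y. metric_comp M g c y b b') (at (cmap c p)) a" for a b b'
  note diff = differentiable_metric_comp[OF g assms(4)]
  have der: "((\<lambda>y. metric_comp M g c y b b') has_derivative (\<lambda>a. D a b b')) (at (cmap c p))" for b b'
    unfolding D_def using diff[of b b'] by (simp add: frechet_derivative_works)
  \<comment> \<open>Linearity and symmetry of \<open>D\<close> in \<open>b\<close> and
    \<open>b'\<close> come from differentiating identities for the metric components that hold on
    the whole chart image.\<close>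
  have cong: "D a b b' = f' a"
    if "(f has_derivative f') (at (cmap c p))" and "\<And>y. y \<in> cimage c \<Longrightarrow> metric_comp M g c y b b' = f y"
    for a b b' f f'
  proof -
    have "frechet_derivative (\<lambda>y. metric_comp M g c y b b') (at (cmap c p)) = frechet_derivative f (at (cmap c p))"
      by (rule frechet_derivative_cong_open(1)[OF open_cimage[OF assms(1) c(1)] c(2)]) (rule that(2))
    then show ?thesis
      unfolding D_def using frechet_derivative_eqI[OF that(1)] by simp
  qed
  have lin2: "linear (\<lambda>b. D a b b')" for a b'
  proof (rule linearI)
    fix b1 b2 and r :: real
    show "D a (b1 + b2) b' = D a b1 b' + D a b2 b'"
      by (rule cong[OF has_derivative_add[OF der der]])
        (rule bilinear_ladd[OF bilinear_metric_comp[OF assms(1) g _ c(1)]])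
    show "D a (r *\<^sub>R b1) b' = r *\<^sub>R D a b1 b'"
      by (rule cong[OF has_derivative_scaleR_right[OF der]])
        (rule bilinear_lmul[OF bilinear_metric_comp[OF assms(1) g _ c(1)]])
  qed
  have Dsym: "D a b b' = D a b' b" for a b b'
    by (rule cong[OF der]) (rule metric_comp_sym[OF assms(1) g _ c(1)])
  obtain \<Gamma> where \<Gamma>: "metric_connection (metric_comp M g c (cmap c p)) D \<Gamma>"
    by (rule metric_connection_exists[OF bil nd sym has_derivative_linear[OF der] lin2 Dsym])
  have "levi_civita M g c (cmap c p) = (THE \<Gamma>. metric_connection (metric_comp M g c (cmap c p)) D \<Gamma>)"
    by (simp add: levi_civita_def metric_connection_def D_def)
  also have "\<dots> = \<Gamma>"
    using \<Gamma> metric_connection_unique[OF bil nd sym] by (intro the_equality)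
  finally show ?thesis
    using \<Gamma> by (simp add: D_def[abs_def])
qed

lemma metric_comp_conformal:
  "metric_comp M (conformal_metric u g) c y a b = exp (2 * u (cinv c y)) * metric_comp M g c y a b"
  by (simp add: metric_comp_def conformal_metric_def Let_def)

lemma levi_civita_conformal:
  assumes "smooth_manifold M" and "lorentzian_metric M g" and "smooth_fun M u"
    and "p \<in> points M" and "c \<in> charts_at M p"
  obtains G where "levi_civita M (conformal_metric u g) c (cmap c p) = (\<lambda>a b.
      levi_civita M g c (cmap c p) a b
      + frechet_derivative (u \<circ> cinv c) (at (cmap c p)) a *\<^sub>R b
      + frechet_derivative (u \<circ> cinv c) (at (cmap c p)) b *\<^sub>R a
      - metric_comp M g c (cmap c p) a b *\<^sub>R G)"
proof -
  define x where "x = cmap c p"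
  define du where "du = frechet_derivative (u \<circ> cinv c) (at x)"
  define E where "E = exp (2 * u p)"
  define B where "B = metric_comp M g c x"
  define D where "D a b b' = frechet_derivative (\<lambda>y. metric_comp M g c y b b') (at x) a" for a b b'
  have g: "smooth_symmetric_form M g"
    using assms(2) by (simp add: lorentzian_metric_def)
  have c: "c \<in> charts M" "x \<in> cimage c" "cinv c x = p"
    using assms(5) cinv_cmap[OF assms(1)] by (auto simp: charts_at_iff x_def)
  have bil: "bilinear B" and sym: "B a b = B b a" and nd: "nondegenerate B" for a b
    unfolding B_def using bilinear_metric_comp[OF assms(1) g c(2,1)] metric_comp_sym[OF assms(1) g c(2,1)]
      nondegenerate_metric_comp[OF assms(1,2,4,5)] by (simp_all add: x_def)
  have u: "(u \<circ> cinv c) differentiable at x"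
    by (rule smooth_on_differentiable[of "cimage c"]) (use assms(3) c in \<open>auto simp: smooth_fun_def\<close>)
  then have du: "linear du" "((\<lambda>y. u (cinv c y)) has_derivative du) (at x)"
    unfolding du_def by (auto simp: linear_frechet_derivative frechet_derivative_works o_def)
  obtain G where G: "\<And>z. B G z = du z"
    using nondegenerate_represents[OF bil nd du(1)] by metis
  have conn: "metric_connection B D (levi_civita M g c x)"
    using metric_connection_levi_civita[OF assms(1,2,4,5)] by (simp add: B_def D_def[abs_def] x_def)
  define \<Gamma> where "\<Gamma> = (\<lambda>a b. levi_civita M g c x a b + du a *\<^sub>R b + du b *\<^sub>R a - B a b *\<^sub>R G)"
  have \<Gamma>: "metric_connection (\<lambda>a b. E * B a b) (\<lambda>a b b'. E * (2 * du a * B b b' + D a b b')) \<Gamma>"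
    unfolding \<Gamma>_def by (rule metric_connection_conformal[OF bil sym du(1) G conn])
  have E: "E \<noteq> 0"
    by (simp add: E_def)
  \<comment> \<open>Uniqueness is needed for the rescaled form; its nondegeneracy is inherited from
    \<open>B\<close> because \<open>E\<close> is nonzero.\<close>
  have bil': "bilinear (\<lambda>a b. E * B a b)" and sym': "E * B a b = E * B b a"
    and nd': "nondegenerate (\<lambda>a b. E * B a b)" for a b
    using bil nd E sym[of a b]
    by (auto simp: nondegenerate_def bilinear_ladd bilinear_radd bilinear_lmul bilinear_rmul
        algebra_simps intro!: bilinearI_lincomb)
  \<comment> \<open>Product rule for \<open>exp(2u)\<close> times the old components: these are the
    derivative data in \<open>metric_connection_conformal\<close>.\<close>
  have D': "frechet_derivative (\<lambda>y. metric_comp M (conformal_metric u g) c y b b') (at x) a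
      = E * (2 * du a * B b b' + D a b b')" for a b b'
  proof -
    have "((\<lambda>y. metric_comp M g c y b b') has_derivative (\<lambda>a. D a b b')) (at x)"
      unfolding D_def using differentiable_metric_comp[OF g assms(5)] by (simp add: frechet_derivative_works x_def)
    from has_derivative_mult[OF has_derivative_exp[OF has_derivative_mult_right[OF du(2), of 2]] this]
    show ?thesis
      unfolding metric_comp_conformal
      by (subst frechet_derivative_eqI, assumption) (simp add: c(3) E_def B_def algebra_simps)
  qed
  have "levi_civita M (conformal_metric u g) c x = (THE \<Gamma>. metric_connection (\<lambda>a b. E * B a b)
      (\<lambda>a b b'. E * (2 * du a * B b b' + D a b b')) \<Gamma>)"
    unfolding levi_civita_def metric_connection_def D'
    by (simp add: metric_comp_conformal c(3) E_def B_def)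
  also have "\<dots> = \<Gamma>"
    using \<Gamma> metric_connection_unique[OF bil' nd' sym'] by (intro the_equality)
  finally show thesis
    by (intro that[of G]) (simp add: \<Gamma>_def x_def B_def du_def)
qed


section \<open>Spacelike submanifolds\<close>

lemma spacelike_submanifoldD:
  assumes "spacelike_submanifold S M g \<psi>"
  shows "smooth_manifold S" and "smooth_map S M \<psi>"
    and "\<And>s v. s \<in> points S \<Longrightarrow> v \<in> tangent_space S s \<Longrightarrow> v \<noteq> (\<lambda>_. 0) \<Longrightarrow>
      g (\<psi> s) (differential S M \<psi> s v) (differential S M \<psi> s v) > 0"
  using assms
  by (simp_all add: spacelike_submanifold_def immersion_def riemannian_metric_def induced_metric_def)

lemma normal_space_conformal: "normal_space S M (conformal_metric u g) \<psi> s = normal_space S M g \<psi> s"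
  by (simp add: normal_space_def conformal_metric_def)

lemma normal_space_scale:
  assumes "smooth_manifold S" and "smooth_manifold M" and "smooth_map S M \<psi>" and "s \<in> points S"
    and "smooth_symmetric_form M g" and "w \<in> normal_space S M g \<psi> s"
  shows "(\<lambda>c. r *\<^sub>R w c) \<in> normal_space S M g \<psi> s"
  using assms(6) tangent_space_scale[OF assms(2) smooth_map_point[OF assms(3,4)]]
    form_scale_left[OF assms(2,5) smooth_map_point[OF assms(3,4)] _ differential_tangent[OF assms(1-4)]]
  by (simp add: normal_space_def)

text \<open>Orthogonal projection to the tangent space of S: in coordinates the condition on
  \<open>a\<close> is a linear equation for the induced metric, which is positive definite and hence
  nondegenerate. The plus sign fits the Weingarten convention, where the tangential part is minus
  the shape operator.\<close>

lemma tangential_part_ex1: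
  assumes "smooth_manifold M" and "smooth_symmetric_form M g" and "spacelike_submanifold S M g \<psi>"
    and "s \<in> points S" and "w \<in> tangent_space M (\<psi> s)"
  shows "\<exists>!a. a \<in> tangent_space S s \<and>
    (\<lambda>c. w c + differential S M \<psi> s a c) \<in> normal_space S M g \<psi> s"
proof -
  note S = spacelike_submanifoldD(1,2)[OF assms(3)]
  note p = smooth_map_point[OF S(2) assms(4)]
  define d where "d = chart_at S s"
  have d: "d \<in> charts_at S s"
    unfolding d_def by (rule chart_at_in_charts_at[OF S(1) assms(4)])
  define F where "F a = differential S M \<psi> s (coord_vec S d s a)" for a
  have F: "F a \<in> tangent_space M (\<psi> s)" for a
    unfolding F_def by (rule differential_tangent[OF S(1) assms(1) S(2) assms(4)])
  have F_lin: "F (r *\<^sub>R a + b) = (\<lambda>c. r *\<^sub>R F a c + F b c)" for r a b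
    unfolding F_def coord_vec_lincomb[OF S(1) d] by (rule differential_lincomb[OF S assms(4)])
  have FI: "F (v d) = differential S M \<psi> s v" if "v \<in> tangent_space S s" for v
    unfolding F_def coord_vec_component[OF that d] ..
  define B where "B a b = g (\<psi> s) (F a) (F b)" for a b
  have bil: "bilinear B"
    by (rule bilinearI_lincomb) (simp_all add: B_def F_lin form_lincomb_left[OF assms(2) p F F F]
        form_lincomb_right[OF assms(1,2) p F F F])
  have "a = 0" if "B a a = 0" for a
  proof (rule ccontr)
    assume "a \<noteq> 0"
    then have "coord_vec S d s a \<noteq> (\<lambda>_. 0)"
      using coord_vec_self[OF S(1) d, of a] by auto
    then show False
      using spacelike_submanifoldD(3)[OF assms(3,4) coord_vec_tangent[OF S(1) d]] that
      by (fastforce simp: B_def F_def)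
  qed
  then have nd: "nondegenerate B"
    by (simp add: nondegenerate_def)
  have "linear (\<lambda>b. - g (\<psi> s) w (F b))"
    by (rule linearI_lincomb) (simp add: F_lin form_lincomb_right[OF assms(1,2) p F F assms(5)])
  from nondegenerate_represents[OF bil nd this]
  obtain a where a: "\<And>z. B a z = - g (\<psi> s) w (F z)"
    by blast
  \<comment> \<open>Every tangent vector of S is the \<open>coord_vec\<close> of its component, so
    testing normality against all \<open>F z\<close> is enough.\<close>
  have normal_iff: "(\<lambda>c. w c + differential S M \<psi> s v c) \<in> normal_space S M g \<psi> s
      \<longleftrightarrow> (\<forall>z. B (v d) z = - g (\<psi> s) w (F z))" if v: "v \<in> tangent_space S s" for v
  proof -
    have "(\<lambda>c. w c + differential S M \<psi> s v c) \<in> tangent_space M (\<psi> s)"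
      using tangent_space_lincomb[OF assms(1) p assms(5) F[of "v d"], of 1] by (simp add: FI[OF v])
    moreover have "g (\<psi> s) (\<lambda>c. w c + differential S M \<psi> s v c) (F z) = g (\<psi> s) w (F z) + B (v d) z" for z
      using form_lincomb_left[OF assms(2) p assms(5) F[of "v d"] F[of z], of 1] by (simp add: FI[OF v] B_def)
    moreover have "(\<forall>v'\<in>tangent_space S s.
          g (\<psi> s) (\<lambda>c. w c + differential S M \<psi> s v c) (differential S M \<psi> s v') = 0)
        \<longleftrightarrow> (\<forall>z. g (\<psi> s) (\<lambda>c. w c + differential S M \<psi> s v c) (F z) = 0)"
      using FI coord_vec_tangent[OF S(1) d] unfolding F_def by metis
    ultimately show ?thesis
      by (simp add: normal_space_def add_eq_0_iff)
  qed
  show ?thesis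
  proof (rule ex1I)
    show "coord_vec S d s a \<in> tangent_space S s \<and>
        (\<lambda>c. w c + differential S M \<psi> s (coord_vec S d s a) c) \<in> normal_space S M g \<psi> s"
      using coord_vec_tangent[OF S(1) d] normal_iff[OF coord_vec_tangent[OF S(1) d]] a
      by (simp add: coord_vec_self[OF S(1) d])
  next
    fix v assume v: "v \<in> tangent_space S s \<and>
        (\<lambda>c. w c + differential S M \<psi> s v c) \<in> normal_space S M g \<psi> s"
    then have "\<forall>z. B (v d) z = - g (\<psi> s) w (F z)"
      using normal_iff by blast
    then have "v d = a"
      using a by (intro nondegenerate_eqI[OF bil nd]) simp
    then show "v = coord_vec S d s a"
      using v coord_vec_component[OF _ d] by metis
  qed
qed

text \<open>The number \<open>r\<close> is \<open>du\<close> applied to \<open>\<zeta> s\<close>. It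
  multiplies a tangential vector, so it will be absorbed by the shape operator.\<close>

lemma covariant_derivative_conformal:
  assumes "smooth_manifold M" and "lorentzian_metric M g" and "smooth_fun M u"
    and "spacelike_submanifold S M g \<psi>" and "s \<in> points S" and "v \<in> tangent_space S s"
    and "\<zeta> s \<in> normal_space S M g \<psi> s"
    and "(\<lambda>y. \<zeta> (cinv (chart_at S s) y) (chart_at M (\<psi> s))) differentiable at (cmap (chart_at S s) s)"
  obtains r where
    "covariant_derivative S M (conformal_metric u g) \<psi> (\<lambda>s c. exp (- u (\<psi> s)) *\<^sub>R \<zeta> s c) s v
      = (\<lambda>c. exp (- u (\<psi> s)) *\<^sub>R (covariant_derivative S M g \<psi> \<zeta> s v c + r *\<^sub>R differential S M \<psi> s v c))"
proof -
  note S = spacelike_submanifoldD(1,2)[OF assms(4)]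
  note p = smooth_map_point[OF S(2) assms(5)]
  have g: "smooth_symmetric_form M g"
    using assms(2) by (simp add: lorentzian_metric_def)
  define d where "d = chart_at S s"
  define c where "c = chart_at M (\<psi> s)"
  have d: "d \<in> charts_at S s" and c: "c \<in> charts_at M (\<psi> s)"
    unfolding d_def c_def using chart_at_in_charts_at[OF S(1) assms(5)] chart_at_in_charts_at[OF assms(1) p] by simp_all
  have s: "cinv d (cmap d s) = s"
    using d cinv_cmap[OF S(1)] by (simp add: charts_at_iff)
  define x where "x = cmap c (\<psi> s)"
  define du where "du = frechet_derivative (u \<circ> cinv c) (at x)"
  define w where "w = differential S M \<psi> s v c"
  define Z where "Z y = \<zeta> (cinv d y) c" for y
  define DZ where "DZ = frechet_derivative Z (at (cmap d s))"
  define e where "e = exp (- u (\<psi> s))"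
  have dv: "differential S M \<psi> s v \<in> tangent_space M (\<psi> s)"
    by (rule differential_tangent[OF S(1) assms(1) S(2) assms(5)])
  have zt: "\<zeta> s \<in> tangent_space M (\<psi> s)" and z0: "g (\<psi> s) (\<zeta> s) (differential S M \<psi> s v) = 0"
    using assms(6,7) by (auto simp: normal_space_def)
  have lin_du: "linear du"
    unfolding du_def x_def
    by (rule linear_frechet_derivative, rule smooth_on_differentiable[of "cimage c"])
      (use assms(3) c in \<open>auto simp: smooth_fun_def charts_at_iff\<close>)
  have "bilinear (levi_civita M g c x)"
    using metric_connection_levi_civita[OF assms(1,2) p c] by (simp add: metric_connection_def x_def)
  note lc_scale = bilinear_rmul[OF this]
  \<comment> \<open>Normality of \<zeta> enters here: it removes the gradient term of the conformal
    connection.\<close>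
  have B0: "metric_comp M g c x w (e *\<^sub>R \<zeta> s c) = 0"
  proof -
    have "metric_comp M g c x w (\<zeta> s c) = 0"
      unfolding x_def w_def metric_comp_cmap[OF assms(1) c] coord_vec_component[OF dv c] coord_vec_component[OF zt c]
      using form_sym[OF g p dv zt] z0 by simp
    moreover have "bilinear (metric_comp M g c x)"
      by (rule bilinear_metric_comp[OF assms(1) g]) (use c in \<open>auto simp: x_def charts_at_iff\<close>)
    ultimately show ?thesis
      by (simp add: bilinear_rmul)
  qed
  have Zs: "Z (cmap d s) = \<zeta> s c"
    by (simp add: Z_def s)
  have "(Z has_derivative DZ) (at (cmap d s))"
    unfolding DZ_def Z_def using assms(8) by (simp add: frechet_derivative_works d_def c_def)
  moreover have "((\<lambda>y. u (\<psi> (cinv d y))) has_derivative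
      (\<lambda>a. du (frechet_derivative (cmap c \<circ> \<psi> \<circ> cinv d) (at (cmap d s)) a))) (at (cmap d s))"
    unfolding du_def x_def d_def by (rule has_derivative_compose_map[OF S(1) assms(1) S(2) assms(5,3) c])
  ultimately have "((\<lambda>y. exp (- u (\<psi> (cinv d y))) *\<^sub>R Z y) has_derivative
      (\<lambda>a. e *\<^sub>R DZ a - (e * du (frechet_derivative (cmap c \<circ> \<psi> \<circ> cinv d) (at (cmap d s)) a)) *\<^sub>R \<zeta> s c))
      (at (cmap d s))"
    by (auto intro!: derivative_eq_intros simp: s e_def Zs)
  from frechet_derivative_eqI[OF this, of "v d"]
  have deriv: "frechet_derivative (\<lambda>y. exp (- u (\<psi> (cinv d y))) *\<^sub>R Z y) (at (cmap d s)) (v d)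
      = e *\<^sub>R DZ (v d) - (e * du w) *\<^sub>R \<zeta> s c"
    using c by (simp add: w_def differential_def Let_def flip: d_def)
  obtain G where G: "levi_civita M (conformal_metric u g) c x = (\<lambda>a b.
      levi_civita M g c x a b + du a *\<^sub>R b + du b *\<^sub>R a - metric_comp M g c x a b *\<^sub>R G)"
    using levi_civita_conformal[OF assms(1-3) p c] unfolding x_def du_def by blast
  \<comment> \<open>The term \<open>- e du(w)\<close> times \<open>\<zeta> s c\<close> from
    differentiating the weight cancels the term \<open>du w\<close> of the conformal
    connection.\<close>
  have "frechet_derivative (\<lambda>y. exp (- u (\<psi> (cinv d y))) *\<^sub>R Z y) (at (cmap d s)) (v d)
      + levi_civita M (conformal_metric u g) c x w (e *\<^sub>R \<zeta> s c)
    = e *\<^sub>R (du (\<zeta> s c) *\<^sub>R w + (DZ (v d) + levi_civita M g c x w (\<zeta> s c)))"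
    by (simp add: deriv G B0 lc_scale linear_scale[OF lin_du] algebra_simps)
  then have "covariant_derivative S M (conformal_metric u g) \<psi> (\<lambda>s c. exp (- u (\<psi> s)) *\<^sub>R \<zeta> s c) s v
      = coord_vec M c (\<psi> s) (e *\<^sub>R (du (\<zeta> s c) *\<^sub>R w + (DZ (v d) + levi_civita M g c x w (\<zeta> s c))))"
    by (simp add: covariant_derivative_def Let_def Z_def e_def w_def x_def flip: d_def c_def)
  also have "\<dots> = (\<lambda>c'. e *\<^sub>R (du (\<zeta> s c) *\<^sub>R coord_vec M c (\<psi> s) w c'
      + coord_vec M c (\<psi> s) (DZ (v d) + levi_civita M g c x w (\<zeta> s c)) c'))"
    by (simp add: coord_vec_scale[OF assms(1) c] coord_vec_lincomb[OF assms(1) c])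
  also have "coord_vec M c (\<psi> s) w = differential S M \<psi> s v"
    unfolding w_def by (rule coord_vec_component[OF dv c])
  also have "coord_vec M c (\<psi> s) (DZ (v d) + levi_civita M g c x w (\<zeta> s c))
      = covariant_derivative S M g \<psi> \<zeta> s v"
    by (simp add: covariant_derivative_def Let_def DZ_def Z_def[abs_def] w_def x_def flip: d_def c_def)
  finally show thesis
    by (intro that[of "du (\<zeta> s c)"]) (simp add: e_def add.commute)
qed

lemma covariant_derivative_tangent:
  assumes "smooth_manifold M" and "\<psi> s \<in> points M"
  shows "covariant_derivative S M g \<psi> \<zeta> s v \<in> tangent_space M (\<psi> s)"
  unfolding covariant_derivative_def Let_def
  by (rule coord_vec_tangent[OF assms(1) chart_at_in_charts_at[OF assms]])

lemma normal_connection_conformal: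
  assumes "smooth_manifold M" and "lorentzian_metric M g" and "smooth_fun M u"
    and "spacelike_submanifold S M g \<psi>" and "s \<in> points S" and "v \<in> tangent_space S s"
    and "\<zeta> s \<in> normal_space S M g \<psi> s"
    and "(\<lambda>y. \<zeta> (cinv (chart_at S s) y) (chart_at M (\<psi> s))) differentiable at (cmap (chart_at S s) s)"
  shows "normal_connection S M (conformal_metric u g) \<psi> (\<lambda>s c. exp (- u (\<psi> s)) *\<^sub>R \<zeta> s c) s v
    = (\<lambda>c. exp (- u (\<psi> s)) *\<^sub>R normal_connection S M g \<psi> \<zeta> s v c)"
proof -
  note S = spacelike_submanifoldD(1,2)[OF assms(4)]
  note p = smooth_map_point[OF S(2) assms(5)]
  have g: "smooth_symmetric_form M g"
    using assms(2) by (simp add: lorentzian_metric_def)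
  define e where "e = exp (- u (\<psi> s))"
  define N where "N = covariant_derivative S M g \<psi> \<zeta> s v"
  define N' where "N' = covariant_derivative S M (conformal_metric u g) \<psi> (\<lambda>s c. exp (- u (\<psi> s)) *\<^sub>R \<zeta> s c) s v"
  define A where "A = shape_operator S M g \<psi> \<zeta> s v"
  obtain r where N': "N' = (\<lambda>c. e *\<^sub>R (N c + r *\<^sub>R differential S M \<psi> s v c))"
    unfolding N'_def N_def e_def by (rule covariant_derivative_conformal[OF assms])
  have N: "N \<in> tangent_space M (\<psi> s)" "N' \<in> tangent_space M (\<psi> s)"
    unfolding N_def N'_def using covariant_derivative_tangent[where \<psi> = \<psi>, OF assms(1) p] by auto
  have A: "A \<in> tangent_space S s" "(\<lambda>c. N c + differential S M \<psi> s A c) \<in> normal_space S M g \<psi> s"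
    using theI'[OF tangential_part_ex1[OF assms(1) g assms(4,5) N(1)]]
    unfolding A_def shape_operator_def N_def by auto
  \<comment> \<open>Chosen so that \<open>- r v\<close> removes the extra tangential term of
    \<open>N'\<close>; what remains is \<open>e\<close> times the normal part for
    \<open>g\<close>.\<close>
  define A' where "A' = (\<lambda>d. e *\<^sub>R (- r *\<^sub>R v d + A d))"
  have dA': "differential S M \<psi> s A' = (\<lambda>c. e *\<^sub>R (- r *\<^sub>R differential S M \<psi> s v c + differential S M \<psi> s A c))"
    unfolding A'_def differential_scale[OF S assms(5)] differential_lincomb[OF S assms(5)] ..
  have sum: "(\<lambda>c. N' c + differential S M \<psi> s A' c) = (\<lambda>c. e *\<^sub>R (N c + differential S M \<psi> s A c))"
    unfolding N' dA' by (simp add: algebra_simps)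
  have "A' \<in> tangent_space S s"
    unfolding A'_def
    by (intro tangent_space_scale[OF S(1) assms(5)] tangent_space_lincomb[OF S(1) assms(5)] assms(6) A(1))
  moreover have "(\<lambda>c. N' c + differential S M \<psi> s A' c) \<in> normal_space S M g \<psi> s"
    unfolding sum by (rule normal_space_scale[OF S(1) assms(1) S(2) assms(5) g A(2)])
  \<comment> \<open>As the normal spaces agree, the description for the new metric asks for the
    tangential part of \<open>N'\<close> with respect to \<open>g\<close>, which is unique.\<close>
  ultimately have "shape_operator S M (conformal_metric u g) \<psi> (\<lambda>s c. exp (- u (\<psi> s)) *\<^sub>R \<zeta> s c) s v = A'"
    unfolding shape_operator_def normal_space_conformal N'_def[symmetric]
    by (intro the1_equality[OF tangential_part_ex1[OF assms(1) g assms(4,5) N(2)]] conjI)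
  then show ?thesis
    unfolding normal_connection_def N'_def[symmetric] N_def[symmetric] A_def[symmetric] e_def[symmetric]
    using sum by simp
qed

lemma parallel_normal_conformal:
  assumes "smooth_manifold M" and "lorentzian_metric M g" and "smooth_fun M u"
    and "spacelike_submanifold S M g \<psi>"
    and "\<And>s. s \<in> points S \<Longrightarrow> \<zeta> s \<in> normal_space S M g \<psi> s"
    and "\<And>s. s \<in> points S \<Longrightarrow>
      (\<lambda>y. \<zeta> (cinv (chart_at S s) y) (chart_at M (\<psi> s))) differentiable at (cmap (chart_at S s) s)"
  shows "parallel_normal S M (conformal_metric u g) \<psi> (\<lambda>s c. exp (- u (\<psi> s)) *\<^sub>R \<zeta> s c)
    \<longleftrightarrow> parallel_normal S M g \<psi> \<zeta>"
  unfolding parallel_normal_def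
  using normal_connection_conformal[OF assms(1-4) _ _ assms(5,6)] by (simp add: fun_eq_iff)

theorem corollary5p6:
  fixes M :: "('a, 'e::euclidean_space) manifold"
    and g :: "('a, 'e) metric"
    and \<tau> :: "'a \<Rightarrow> ('a, 'e) tvec set"
    and u :: "'a \<Rightarrow> real"
    and S :: "('s, 'f::euclidean_space) manifold"
    and \<psi> :: "'s \<Rightarrow> 'a"
    and \<xi> :: "'s \<Rightarrow> ('a, 'e) tvec"
  assumes "DIM('e) = DIM('f) + 2" and "DIM('e) \<ge> 4"
    and "spacetime M g \<tau>"
    and "smooth_fun M u"
    and "spacelike_submanifold S M g \<psi>"
    and "normal_field S M g \<psi> \<xi>"
    and "\<forall>s\<in>points S. lightlike g (\<psi> s) (\<xi> s)"
    and "umbilical S M g \<psi> \<xi>"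
  shows "rescalable_to_parallel S M g \<psi> \<xi> \<longleftrightarrow>
         rescalable_to_parallel S M (conformal_metric u g) \<psi> \<xi>"
proof -
  have M: "smooth_manifold M" and lor: "lorentzian_metric M g"
    using assms(3) by (simp_all add: spacetime_def)
  have g: "smooth_symmetric_form M g"
    using lor by (simp add: lorentzian_metric_def)
  note S = spacelike_submanifoldD(1,2)[OF assms(5)]
  have iff: "parallel_normal S M (conformal_metric u g) \<psi> (\<lambda>s c. (exp (- u (\<psi> s)) * h s) *\<^sub>R \<xi> s c)
      \<longleftrightarrow> parallel_normal S M g \<psi> (\<lambda>s c. h s *\<^sub>R \<xi> s c)" if h: "smooth_fun S h" for h
  proof -
    have "(\<lambda>c. h s *\<^sub>R \<xi> s c) \<in> normal_space S M g \<psi> s" if "s \<in> points S" for s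
      using assms(6) that by (intro normal_space_scale[OF S(1) M S(2) that g]) (simp add: normal_field_def)
    moreover have "(\<lambda>y. h (cinv (chart_at S s) y) *\<^sub>R \<xi> (cinv (chart_at S s) y) (chart_at M (\<psi> s)))
        differentiable at (cmap (chart_at S s) s)" if s: "s \<in> points S" for s
    proof -
      note d = chart_at_in_charts_at[OF S(1) s]
      note c = chart_at_in_charts_at[OF M smooth_map_point[OF S(2) s]]
      have "smooth_on (cimage (chart_at S s)) (h \<circ> cinv (chart_at S s))"
        using h d by (simp add: smooth_fun_def charts_at_iff)
      then have dh: "(h \<circ> cinv (chart_at S s)) differentiable at (cmap (chart_at S s) s)"
        by (rule smooth_on_differentiable) (use d in \<open>simp add: charts_at_iff\<close>)
      have "smooth_on (cmap (chart_at S s) ` (cdom (chart_at S s) \<inter> \<psi> -` cdom (chart_at M (\<psi> s))))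
          (\<lambda>y. \<xi> (cinv (chart_at S s) y) (chart_at M (\<psi> s)))"
        using assms(6) c d by (simp add: normal_field_def smooth_field_along_def charts_at_iff)
      then have "(\<lambda>y. \<xi> (cinv (chart_at S s) y) (chart_at M (\<psi> s))) differentiable at (cmap (chart_at S s) s)"
        by (rule smooth_on_differentiable) (use c d in \<open>simp add: charts_at_iff\<close>)
      from differentiable_scaleR[OF dh this] show ?thesis
        by (simp add: o_def)
    qed
    ultimately show ?thesis
      using parallel_normal_conformal[OF M lor assms(4,5), of "\<lambda>s c. h s *\<^sub>R \<xi> s c"] by simp
  qed
  \<comment> \<open>The forward direction uses \<open>r = -1\<close>, the converse
    \<open>r = 1\<close>.\<close>
  have smooth: "smooth_fun S (\<lambda>s. exp (r * u (\<psi> s)) * h s)" if "smooth_fun S h" for r h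
    by (rule smooth_fun_mult[OF S(1) smooth_fun_exp[OF S(1) smooth_fun_compose[OF S(1) M S(2) assms(4)]] that])
  show ?thesis
  proof
    assume "rescalable_to_parallel S M g \<psi> \<xi>"
    then obtain h where h: "smooth_fun S h" "\<forall>s\<in>points S. h s \<noteq> 0"
      "parallel_normal S M g \<psi> (\<lambda>s c. h s *\<^sub>R \<xi> s c)"
      unfolding rescalable_to_parallel_def by blast
    show "rescalable_to_parallel S M (conformal_metric u g) \<psi> \<xi>"
      unfolding rescalable_to_parallel_def
      using h smooth[OF h(1), of "- 1"] iff[OF h(1)]
      by (intro exI[of _ "\<lambda>s. exp (- u (\<psi> s)) * h s"]) simp
  next
    assume "rescalable_to_parallel S M (conformal_metric u g) \<psi> \<xi>"
    then obtain h where h: "smooth_fun S h" "\<forall>s\<in>points S. h s \<noteq> 0"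
      "parallel_normal S M (conformal_metric u g) \<psi> (\<lambda>s c. h s *\<^sub>R \<xi> s c)"
      unfolding rescalable_to_parallel_def by blast
    have h': "smooth_fun S (\<lambda>s. exp (u (\<psi> s)) * h s)"
      using smooth[OF h(1), of 1] by simp
    \<comment> \<open>For the converse, \<open>iff\<close> is applied to \<open>exp(u) h\<close>,
      whose weighted version is the given \<open>h\<close>.\<close>
    have "exp (- u (\<psi> s)) * (exp (u (\<psi> s)) * h s) = h s" for s
      by (simp add: exp_minus)
    with iff[OF h'] h(3) have "parallel_normal S M g \<psi> (\<lambda>s c. (exp (u (\<psi> s)) * h s) *\<^sub>R \<xi> s c)"
      by simp
    then show "rescalable_to_parallel S M g \<psi> \<xi>"
      unfolding rescalable_to_parallel_def
      using h' h(2) by (intro exI[of _ "\<lambda>s. exp (u (\<psi> s)) * h s"]) simp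
  qed
qed

end
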